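(* Let $K$ be a (non-degenerate, shape-regular) triangle of diameter $h_K$ and $\mathbb{X}(K)=\operatorname{sym}(\boldsymbol{RT}^0(K)\otimes\boldsymbol{RT}^1(K))$. The elements of $$\mathbb{B}:=\{\boldsymbol N^\triangle_{(j,k)},\boldsymbol T^\triangle_{(j,k)},\boldsymbol J^\triangle_j: j=1,2,3,\ k=0,1\}$$ define a basis of $\mathbb{X}(K)$ and are dual to the degrees of freedom $$\tfrac{1}{\|\ell_{E_\ell,m}\|^2_{E_\ell}}\langle\mathrm{tr}_{K,E_\ell,\boldsymbol n}\boldsymbol M,\ell_{E_\ell,m}\rangle_{E_\ell},\quad\langle\mathrm{tr}_{K,E_\ell,\boldsymbol t}\boldsymbol M,\ell_{E_\ell,m}\rangle_{E_\ell},\quad[\boldsymbol t\cdot\boldsymbol M\boldsymbol n]_{\partial K}(z_\ell)\qquad(\ell=1,2,3,\ m=0,1),$$ where $\boldsymbol N^\triangle_{(j,k)}$, $\boldsymbol T^\triangle_{(j,k)}$, $\boldsymbol J^\triangle_j$ correspond to the functionals of the first, second and third type with $(\ell,m)=(j,k)$, $(\ell,m)=(j,k)$, $\ell=j$, respectively. Moreover, $\|\boldsymbol B\|_K\eqsim h_K$ for all $\boldsymbol B\in\mathbb{B}$, with equivalence constants depending only on the shape-regularity of $K$.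
   Context: $\boldsymbol{RT}^p(K)=P^p(K)^2\oplus\boldsymbol xP^p_{\mathrm{hom}}(K)$, where $P^p(K)$ are polynomials of degree $\le p$, $P^p_{\mathrm{hom}}(K)$ the homogeneous ones, $\boldsymbol x:(x,y)\mapsto(x,y)^\top$; $\operatorname{sym}(\boldsymbol M)=\frac12(\boldsymbol M+\boldsymbol M^\top)$ (applied to spaces: image); $\boldsymbol X\otimes\boldsymbol Y=\operatorname{span}\{\boldsymbol\phi\boldsymbol\psi^\top\}$. $\|\cdot\|_K$, $\langle\cdot,\cdot\rangle_E$, $\|\cdot\|_E$: $L_2$ norm on $K$, inner product and norm on $E$. Geometry. $\widehat K$: reference triangle with vertices $\widehat z_1=(0,0),\widehat z_2=(1,0),\widehat z_3=(0,1)$. $K$ has vertices $z_1,z_2,z_3$ (positive order); $F_K(\widehat{\boldsymbol x})=\boldsymbol B_K\widehat{\boldsymbol x}+z_1$, $\boldsymbol B_K=(z_2-z_1\;\;z_3-z_1)$. Edge $E_j$ goes from $z_j$ to $z_{j+1}$ (cyclic indices modulo 3), with unit tangent $\boldsymbol t_j$ (positive orientation) and unit exterior normal $\boldsymbol n_j$; $\eta_j$ are the barycentric coordinates ($\eta_j(z_k)=\delta_{jk}$). Hatted symbols $\widehat E_j,\widehat{\boldsymbol t}_j,\widehat{\boldsymbol n}_j,\widehat\eta_j$ denote the same for $\widehat K$. $\mathcal{H}_K$: Piola–Kirchhoff transformation, $\boldsymbol M=\mathcal{H}_K(\widehat{\boldsymbol M})$ with $\det(\boldsymbol B_K)\boldsymbol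 M\circ F_K=\boldsymbol B_K\widehat{\boldsymbol M}\boldsymbol B_K^\top$. Traces (for $K$ and likewise $\widehat K$). $\mathrm{tr}_{K,E,\boldsymbol n}\boldsymbol M=\boldsymbol n\cdot\boldsymbol M\boldsymbol n|_E$; $\mathrm{tr}_{K,E,\boldsymbol t}\boldsymbol M=(\boldsymbol n\cdot\mathbf{div}\boldsymbol M+\partial_{\boldsymbol t}(\boldsymbol t\cdot\boldsymbol M\boldsymbol n))|_E$ ($\mathbf{div}$ row-wise); $[\boldsymbol t\cdot\boldsymbol M\boldsymbol n]_{\partial K}(z_j)=(\boldsymbol t\cdot\boldsymbol M\boldsymbol n)|_{E_{j-1}}(z_j)-(\boldsymbol t\cdot\boldsymbol M\boldsymbol n)|_{E_j}(z_j)$. $\ell_{E,k}$: Legendre polynomial of degree $k$ on $E$ with value $1$ at the end point of $E$. Tensors $\boldsymbol T^\triangle_{(j,k)}=\mathcal{H}_K(\widehat{\boldsymbol T}^\triangle_{(j,k)})$, where (writing symmetric tensors as $(M_{11},M_{12},M_{22})$) $\widehat{\boldsymbol T}^\triangle_{(1,0)}=(-x^2y,\ -xy(y-1),\ -y(y-1)^2)$; $\widehat{\boldsymbol T}^\triangle_{(1,1)}=(x^2(2x+y-2),\ x(2xy-2y-x+y^2+1),\ y(y-1)(2x+y-1))$; $\widehat{\boldsymbol T}^\triangle_{(2,0)}=(x^2(x+y-1),\ xy(x+y-1),\ y^2(x+y-1))$; $\widehat{\boldsymbol T}^\triangle_{(2,1)}=(x^2(y-x+1),\ -xy(x-y),\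 -y^2(x-y+1))$; $\widehat{\boldsymbol T}^\triangle_{(3,0)}=(-x(x-1)^2,\ -xy(x-1),\ -xy^2)$; $\widehat{\boldsymbol T}^\triangle_{(3,1)}=(-x(x-1)(x+2y-1),\ -y(2xy-y-2x+x^2+1),\ -y^2(x+2y-2))$. Tensors $\boldsymbol J^\triangle_j=\mathcal{H}_K(\widehat{\boldsymbol J}^\triangle_j)$ with $\widetilde{\boldsymbol J}^\triangle_j=\frac{2}{\widehat{\boldsymbol t}_j\cdot\widehat{\boldsymbol n}_{j+2}-\widehat{\boldsymbol t}_{j+2}\cdot\widehat{\boldsymbol n}_j}\operatorname{sym}(\widehat{\boldsymbol t}_j\widehat{\boldsymbol t}_{j+2}^\top)\widehat\eta_j$ and $\widehat{\boldsymbol J}^\triangle_j=\widetilde{\boldsymbol J}^\triangle_j-\sum_{\ell=1}^3\langle\mathrm{tr}_{\widehat K,\widehat E_\ell,\boldsymbol t}\widetilde{\boldsymbol J}^\triangle_j,1\rangle_{\widehat E_\ell}\widehat{\boldsymbol T}^\triangle_{(\ell,0)}$. Tensors $\boldsymbol N^\triangle_{(j,k)}$: with $\widetilde{\boldsymbol N}^\triangle_{(j,0)}=\frac{1}{(\boldsymbol t_{j+1}\cdot\boldsymbol n_j)(\boldsymbol t_{j+2}\cdot\boldsymbol n_j)}\operatorname{sym}(\boldsymbol t_{j+1}\boldsymbol t_{j+2}^\top)$ and $\widetilde{\boldsymbol N}^\triangle_{(j,1)}=\widetilde{\boldsymbol N}^\triangle_{(j,0)}(\eta_{j+1}-\eta_j)$,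 $\boldsymbol N^\triangle_{(j,0)}=\widetilde{\boldsymbol N}^\triangle_{(j,0)}-\sum_{\ell=1}^3[\boldsymbol t\cdot\widetilde{\boldsymbol N}^\triangle_{(j,0)}\boldsymbol n]_{\partial K}(z_\ell)\boldsymbol J^\triangle_\ell$, $\boldsymbol N^\triangle_{(j,1)}=\widetilde{\boldsymbol N}^\triangle_{(j,1)}-\sum_{\ell=1}^3\langle\mathrm{tr}_{K,E_\ell,\boldsymbol t}\widetilde{\boldsymbol N}^\triangle_{(j,1)},1\rangle_{E_\ell}\boldsymbol T^\triangle_{(\ell,0)}-\sum_{\ell=1}^3[\boldsymbol t\cdot\widetilde{\boldsymbol N}^\triangle_{(j,1)}\boldsymbol n]_{\partial K}(z_\ell)\boldsymbol J^\triangle_\ell$. *)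

theory Defs
  imports "HOL-Analysis.Analysis" "HOL-Library.Function_Algebras"
begin

text \<open>Fields are added and scaled pointwise, so that spaces of fields are real vector spaces.\<close>

instantiation "fun" :: (type, real_vector) real_vector
begin

definition scaleR_fun :: "real \<Rightarrow> ('a \<Rightarrow> 'b) \<Rightarrow> 'a \<Rightarrow> 'b"
  where "scaleR_fun c f = (\<lambda>x. c *\<^sub>R f x)"

instance
  by standard (simp_all add: scaleR_fun_def fun_eq_iff scaleR_right_distrib scaleR_left_distrib)

end

lemma scaleR_fun_apply [simp]: "(c *\<^sub>R f) x = c *\<^sub>R f x"
  by (simp add: scaleR_fun_def)


section \<open>Polynomial spaces\<close>

text \<open>
  A polynomial on a (non-degenerate) triangle is identified with the polynomial function on the
  whole plane that it determines. The spaces below therefore carry no reference to the triangle,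
  and derivatives on its boundary are ordinary derivatives.
\<close>

type_synonym scalar_field = "real^2 \<Rightarrow> real"
type_synonym vector_field = "real^2 \<Rightarrow> real^2"
type_synonym tensor_field = "real^2 \<Rightarrow> real^2^2"

definition monomial :: "nat \<Rightarrow> nat \<Rightarrow> scalar_field"
  where "monomial a b = (\<lambda>x. (x$1)^a * (x$2)^b)"

definition Poly :: "nat \<Rightarrow> scalar_field set"
  where "Poly p = span {monomial a b | a b. a + b \<le> p}"

definition Poly_hom :: "nat \<Rightarrow> scalar_field set"
  where "Poly_hom p = span {monomial a b | a b. a + b = p}"

definition RT :: "nat \<Rightarrow> vector_field set"
  where "RT p = {(\<lambda>x. v x + q x *\<^sub>R x) | v q.
                   (\<forall>i. (\<lambda>x. v x $ i) \<in> Poly p) \<and> q \<in> Poly_hom p}"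

definition outer :: "real^2 \<Rightarrow> real^2 \<Rightarrow> real^2^2"
  where "outer u v = (\<chi> a b. u$a * v$b)"

definition sym_part :: "real^2^2 \<Rightarrow> real^2^2"
  where "sym_part M = (1/2) *\<^sub>R (M + transpose M)"

definition tensor_space :: "vector_field set \<Rightarrow> vector_field set \<Rightarrow> tensor_field set"
  where "tensor_space X Y = span {(\<lambda>x. outer (\<phi> x) (\<psi> x)) | \<phi> \<psi>. \<phi> \<in> X \<and> \<psi> \<in> Y}"

definition XX :: "tensor_field set"
  where "XX = (\<lambda>M x. sym_part (M x)) ` tensor_space (RT 0) (RT 1)"


section \<open>Triangles\<close>

text \<open>
  Vertices and edges are indexed by the type \<open>3\<close>, whose arithmetic is modulo 3 (so \<open>3 = 0\<close>
  there): \<open>j + 1\<close>, \<open>j + 2\<close>, \<open>j - 1\<close> are the cyclic index shifts. Edge \<open>j\<close> runs from \<open>z j\<close> to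
  \<open>z (j + 1)\<close>.
\<close>

type_synonym vertices = "3 \<Rightarrow> real^2"

definition ref_triangle :: vertices
  where "ref_triangle j = (if j = 1 then 0 else if j = 2 then axis 1 1 else axis 2 1)"

definition Tri :: "vertices \<Rightarrow> (real^2) set"
  where "Tri z = convex hull (range z)"

definition BK :: "vertices \<Rightarrow> real^2^2"
  where "BK z = transpose (vector [z 2 - z 1, z 3 - z 1])"

definition FK :: "vertices \<Rightarrow> real^2 \<Rightarrow> real^2"
  where "FK z x = BK z *v x + z 1"

definition pos_triangle :: "vertices \<Rightarrow> bool"
  where "pos_triangle z \<longleftrightarrow> det (BK z) > 0"

definition tang :: "vertices \<Rightarrow> 3 \<Rightarrow> real^2"
  where "tang z j = (1 / dist (z j) (z (j + 1))) *\<^sub>R (z (j + 1) - z j)"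

text \<open>For a positively oriented triangle, rotating the tangent clockwise gives the exterior normal
  (see \<open>nrml_exterior\<close>).\<close>

definition nrml :: "vertices \<Rightarrow> 3 \<Rightarrow> real^2"
  where "nrml z j = vector [tang z j $ 2, - (tang z j $ 1)]"

text \<open>Barycentric coordinates as quotients of signed areas (see \<open>bary_vertex\<close>,
  \<open>bary_affine\<close>).\<close>

definition cross2 :: "real^2 \<Rightarrow> real^2 \<Rightarrow> real"
  where "cross2 u v = u$1 * v$2 - u$2 * v$1"

definition bary :: "vertices \<Rightarrow> 3 \<Rightarrow> scalar_field"
  where "bary z j x = cross2 (z (j + 1) - x) (z (j + 2) - x) / det (BK z)"

text \<open>Shape-regularity: quotient of the diameter and the diameter of the largest inscribed disc.\<close>

definition incircle_diameter :: "vertices \<Rightarrow> real"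
  where "incircle_diameter z = Sup {2 * r | r c. r \<ge> 0 \<and> cball c r \<subseteq> Tri z}"

definition shape_regularity :: "vertices \<Rightarrow> real"
  where "shape_regularity z = diameter (Tri z) / incircle_diameter z"

definition L2_norm :: "vertices \<Rightarrow> tensor_field \<Rightarrow> real"
  where "L2_norm z M = sqrt (integral (Tri z) (\<lambda>x. (norm (M x))\<^sup>2))"

definition edge_inner :: "vertices \<Rightarrow> 3 \<Rightarrow> scalar_field \<Rightarrow> scalar_field \<Rightarrow> real"
  where "edge_inner z j f g =
    integral {0..dist (z j) (z (j + 1))}
      (\<lambda>s. f (z j + s *\<^sub>R tang z j) * g (z j + s *\<^sub>R tang z j))"

definition edge_norm :: "vertices \<Rightarrow> 3 \<Rightarrow> scalar_field \<Rightarrow> real"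
  where "edge_norm z j f = sqrt (edge_inner z j f f)"

fun legendre :: "nat \<Rightarrow> real \<Rightarrow> real"
  where
    "legendre 0 s = 1"
  | "legendre (Suc 0) s = s"
  | "legendre (Suc (Suc k)) s =
       ((2 * real k + 3) * s * legendre (Suc k) s - (real k + 1) * legendre k s) / (real k + 2)"

definition edge_legendre :: "vertices \<Rightarrow> 3 \<Rightarrow> nat \<Rightarrow> scalar_field"
  where "edge_legendre z j k x =
    legendre k (2 * ((x - z j) \<bullet> tang z j) / dist (z j) (z (j + 1)) - 1)"


section \<open>Traces and degrees of freedom\<close>

definition Div :: "tensor_field \<Rightarrow> vector_field"
  where "Div M x =
    (\<chi> a. \<Sum>b\<in>UNIV. frechet_derivative (\<lambda>y. M y $ a $ b) (at x) (axis b 1))"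

definition tr_n :: "vertices \<Rightarrow> 3 \<Rightarrow> tensor_field \<Rightarrow> scalar_field"
  where "tr_n z j M x = nrml z j \<bullet> (M x *v nrml z j)"

definition tr_tn :: "vertices \<Rightarrow> 3 \<Rightarrow> tensor_field \<Rightarrow> scalar_field"
  where "tr_tn z j M x = tang z j \<bullet> (M x *v nrml z j)"

definition tr_t :: "vertices \<Rightarrow> 3 \<Rightarrow> tensor_field \<Rightarrow> scalar_field"
  where "tr_t z j M x =
    nrml z j \<bullet> Div M x + frechet_derivative (tr_tn z j M) (at x) (tang z j)"

definition jump :: "vertices \<Rightarrow> 3 \<Rightarrow> tensor_field \<Rightarrow> real"
  where "jump z j M = tr_tn z (j - 1) M (z j) - tr_tn z j M (z j)"

text \<open>The same indices enumerate the degrees of freedom and the basis tensors.\<close>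

datatype dof_index = Nrm 3 nat | Tan 3 nat | Jmp 3

definition dof_indices :: "dof_index set"
  where "dof_indices = {Nrm j k | j k. k \<in> {0, 1}} \<union> {Tan j k | j k. k \<in> {0, 1}} \<union> range Jmp"

fun dof :: "vertices \<Rightarrow> dof_index \<Rightarrow> tensor_field \<Rightarrow> real"
  where
    "dof z (Nrm l m) M =
       1 / (edge_norm z l (edge_legendre z l m))\<^sup>2
         * edge_inner z l (tr_n z l M) (edge_legendre z l m)"
  | "dof z (Tan l m) M = edge_inner z l (tr_t z l M) (edge_legendre z l m)"
  | "dof z (Jmp l) M = jump z l M"


section \<open>Basis tensors\<close>

definition piola :: "vertices \<Rightarrow> tensor_field \<Rightarrow> tensor_field"
  where "piola z M x =
    (1 / det (BK z)) *\<^sub>R (BK z ** M (inv (FK z) x) ** transpose (BK z))"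

definition sym_tensor :: "real \<Rightarrow> real \<Rightarrow> real \<Rightarrow> real^2^2"
  where "sym_tensor a b c = vector [vector [a, b], vector [b, c]]"

text \<open>Only the values \<open>k = 0\<close> and \<open>k = 1\<close> are meaningful for \<open>T_ref\<close>, \<open>T_tri\<close>,
  \<open>N_pre\<close> and \<open>N_tri\<close>.\<close>

definition T_ref :: "3 \<Rightarrow> nat \<Rightarrow> tensor_field"
  where "T_ref j k p = (let x = p$1; y = p$2 in
    if j = 1 then
      (if k = 0
       then sym_tensor (- (x^2 * y)) (- (x * y * (y - 1))) (- (y * (y - 1)^2))
       else sym_tensor (x^2 * (2*x + y - 2)) (x * (2*x*y - 2*y - x + y^2 + 1))
              (y * (y - 1) * (2*x + y - 1)))
    else if j = 2 then
      (if k = 0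
       then sym_tensor (x^2 * (x + y - 1)) (x * y * (x + y - 1)) (y^2 * (x + y - 1))
       else sym_tensor (x^2 * (y - x + 1)) (- (x * y * (x - y))) (- (y^2 * (x - y + 1))))
    else
      (if k = 0
       then sym_tensor (- (x * (x - 1)^2)) (- (x * y * (x - 1))) (- (x * y^2))
       else sym_tensor (- (x * (x - 1) * (x + 2*y - 1))) (- (y * (2*x*y - y - 2*x + x^2 + 1)))
              (- (y^2 * (x + 2*y - 2)))))"

definition T_tri :: "vertices \<Rightarrow> 3 \<Rightarrow> nat \<Rightarrow> tensor_field"
  where "T_tri z j k = piola z (T_ref j k)"

definition J_pre :: "3 \<Rightarrow> tensor_field"
  where "J_pre j = (let t = tang ref_triangle; n = nrml ref_triangle in
    (\<lambda>x. (2 / (t j \<bullet> n (j + 2) - t (j + 2) \<bullet> n j) * bary ref_triangle j x)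
            *\<^sub>R sym_part (outer (t j) (t (j + 2)))))"

definition J_ref :: "3 \<Rightarrow> tensor_field"
  where "J_ref j = J_pre j -
    (\<Sum>l\<in>UNIV. edge_inner ref_triangle l (tr_t ref_triangle l (J_pre j)) (\<lambda>x. 1) *\<^sub>R T_ref l 0)"

definition J_tri :: "vertices \<Rightarrow> 3 \<Rightarrow> tensor_field"
  where "J_tri z j = piola z (J_ref j)"

definition N_pre :: "vertices \<Rightarrow> 3 \<Rightarrow> nat \<Rightarrow> tensor_field"
  where "N_pre z j k = (let t = tang z; n = nrml z in
    (\<lambda>x. (1 / ((t (j + 1) \<bullet> n j) * (t (j + 2) \<bullet> n j))
            * (if k = 0 then 1 else bary z (j + 1) x - bary z j x))
            *\<^sub>R sym_part (outer (t (j + 1)) (t (j + 2)))))"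

definition N_tri :: "vertices \<Rightarrow> 3 \<Rightarrow> nat \<Rightarrow> tensor_field"
  where "N_tri z j k =
    (if k = 0
     then N_pre z j 0 - (\<Sum>l\<in>UNIV. jump z l (N_pre z j 0) *\<^sub>R J_tri z l)
     else N_pre z j 1
          - (\<Sum>l\<in>UNIV. edge_inner z l (tr_t z l (N_pre z j 1)) (\<lambda>x. 1) *\<^sub>R T_tri z l 0)
          - (\<Sum>l\<in>UNIV. jump z l (N_pre z j 1) *\<^sub>R J_tri z l))"

fun basis_tensor :: "vertices \<Rightarrow> dof_index \<Rightarrow> tensor_field"
  where
    "basis_tensor z (Nrm j k) = N_tri z j k"
  | "basis_tensor z (Tan j k) = T_tri z j k"
  | "basis_tensor z (Jmp j) = J_tri z j"

definition BB :: "vertices \<Rightarrow> tensor_field set"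
  where "BB z = basis_tensor z ` dof_indices"


section \<open>Consistency of the geometric definitions\<close>

lemma three_cyclic:
  "(1::3) + 1 = 2" "(1::3) + 2 = 3" "(2::3) + 1 = 3"
  "(2::3) + 2 = 1" "(3::3) + 1 = 1" "(3::3) + 2 = 2"
  by simp_all

lemma BK_nth:
  "BK z $ 1 $ 1 = z 2 $ 1 - z 1 $ 1" "BK z $ 1 $ 2 = z 3 $ 1 - z 1 $ 1"
  "BK z $ 2 $ 1 = z 2 $ 2 - z 1 $ 2" "BK z $ 2 $ 2 = z 3 $ 2 - z 1 $ 2"
  by (simp_all add: BK_def transpose_def)

lemma det_BK_cyclic: "det (BK z) = cross2 (z (j + 1) - z j) (z (j + 2) - z j)"
  using exhaust_3[of j]
  by (elim disjE) (simp_all only: three_cyclic, simp_all add: det_2 BK_nth cross2_def algebra_simps)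

lemma FK_vertices: "FK z (ref_triangle j) = z j"
  using exhaust_3[of j]
  by (elim disjE)
     (simp_all add: FK_def ref_triangle_def vec_eq_iff forall_2 matrix_vector_mult_def sum_2 BK_nth axis_def)

lemma pos_triangle_ref: "pos_triangle ref_triangle"
  by (simp add: pos_triangle_def det_2 BK_nth ref_triangle_def axis_def)

lemma pos_triangle_edge:
  assumes "pos_triangle z"
  shows "z j \<noteq> z (j + 1)"
  using assms det_BK_cyclic[of z j] by (auto simp: pos_triangle_def cross2_def)

lemma nrml_exterior:
  assumes "pos_triangle z"
  shows "norm (tang z j) = 1" "norm (nrml z j) = 1" "nrml z j \<bullet> tang z j = 0"
    "nrml z j \<bullet> (z (j + 2) - z j) < 0"
proof -
  have d: "dist (z j) (z (j + 1)) > 0"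
    using pos_triangle_edge[OF assms] by simp
  show t: "norm (tang z j) = 1"
    using d by (simp add: tang_def dist_norm norm_minus_commute)
  show "norm (nrml z j) = 1"
    using t by (simp add: nrml_def norm_vec_def L2_set_def sum_2 add.commute)
  show "nrml z j \<bullet> tang z j = 0"
    by (simp add: nrml_def inner_vec_def sum_2)
  have "nrml z j \<bullet> (z (j + 2) - z j) = - det (BK z) / dist (z j) (z (j + 1))"
    unfolding det_BK_cyclic[of z j]
    by (simp add: nrml_def inner_vec_def sum_2 tang_def cross2_def diff_divide_distrib
        add_divide_distrib algebra_simps)
  then show "nrml z j \<bullet> (z (j + 2) - z j) < 0"
    using assms d by (simp add: pos_triangle_def)
qed

lemma bary_vertex:
  assumes "pos_triangle z"
  shows "bary z j (z k) = (if k = j then 1 else 0)"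
  using assms exhaust_3[of j] exhaust_3[of k]
  by (elim disjE) (simp_all only: bary_def three_cyclic pos_triangle_def,
      simp_all add: det_2 BK_nth cross2_def algebra_simps)

lemma bary_affine:
  assumes "pos_triangle z"
  shows "(\<Sum>j\<in>UNIV. bary z j x) = 1" "(\<Sum>j\<in>UNIV. bary z j x *\<^sub>R z j) = x"
proof -
  have d: "det (BK z) \<noteq> 0" using assms by (simp add: pos_triangle_def)
  show "(\<Sum>j\<in>UNIV. bary z j x) = 1"
    using d unfolding sum_3 bary_def three_cyclic add_divide_distrib[symmetric]
    by (simp add: det_2 BK_nth cross2_def algebra_simps)
  have "(\<Sum>j\<in>UNIV. bary z j x *\<^sub>R z j) = (1 / det (BK z)) *\<^sub>R
    (cross2 (z 2 - x) (z 3 - x) *\<^sub>R z 1 + cross2 (z 3 - x) (z 1 - x) *\<^sub>R z 2 + cross2 (z 1 - x) (z 2 - x) *\<^sub>R z 3)"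
    unfolding sum_3 bary_def three_cyclic by (simp add: scaleR_add_right)
  also have "cross2 (z 2 - x) (z 3 - x) *\<^sub>R z 1 + cross2 (z 3 - x) (z 1 - x) *\<^sub>R z 2 + cross2 (z 1 - x) (z 2 - x) *\<^sub>R z 3 = det (BK z) *\<^sub>R x"
    by (simp add: vec_eq_iff forall_2 det_2 BK_nth cross2_def algebra_simps)
  finally show "(\<Sum>j\<in>UNIV. bary z j x *\<^sub>R z j) = x" using d by simp
qed

end

theory Submission
  imports Defs
begin

text \<open>Write \<open>e\<^sub>j = z\<^sub>j\<^sub>+\<^sub>1 - z\<^sub>j\<close>, let \<open>D\<close> be twice the area of the triangle,
\<open>\<eta>\<^sub>j\<close> the barycentric coordinates and \<open>u \<odot> v\<close> the symmetric part of \<open>u v\<^sup>T\<close>. The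
Piola--Kirchhoff transformation maps \<open>u \<odot> v\<close> to \<open>(B u \<odot> B v) / D\<close>, so that all reference tensors
have coordinate-free images with a cyclic symmetry in \<open>j\<close>:
  \<^item> \<open>T\<^sub>(\<^sub>j\<^sub>,\<^sub>0\<^sub>)\<close> is \<open>- \<eta>\<^sub>j\<^sub>+\<^sub>2 (x - z\<^sub>j\<^sub>+\<^sub>2) \<odot> (x - z\<^sub>j\<^sub>+\<^sub>2) / D\<close>, and \<open>T\<^sub>(\<^sub>j\<^sub>,\<^sub>1\<^sub>)\<close> is
    \<open>(x - z\<^sub>j\<^sub>+\<^sub>2) \<odot> (\<eta>\<^sub>j\<^sub>+\<^sub>1 (x - z\<^sub>j\<^sub>+\<^sub>1) - \<eta>\<^sub>j (x - z\<^sub>j)) / D\<close> (\<open>T_tri_0\<close>, \<open>T_tri_1\<close>);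
  \<^item> \<open>J\<^sub>j\<close> is \<open>- \<eta>\<^sub>j e\<^sub>j \<odot> e\<^sub>j\<^sub>+\<^sub>2 / D\<close>, called the corner tensor, corrected by the three
    \<open>T\<^sub>(\<^sub>l\<^sub>,\<^sub>0\<^sub>)\<close> with coefficients \<open>\<plusminus>1\<close> (\<open>J_tri_eq\<close>).

Duality is then a computation on one edge \<open>l\<close> in its orthonormal frame \<open>(t, n)\<close>. Along the edge the
vectors \<open>x - z\<^sub>l\<close> and \<open>x - z\<^sub>l\<^sub>+\<^sub>1\<close> are multiples of \<open>t\<close>, the normal components of the edge vectors
are \<open>0\<close> and \<open>\<plusminus>D\<close> over the length of the edge, and the derivatives of the barycentric coordinates that
occur are explicit. All traces of the tensors turn out to be affine functions of arc length, whose Legendre moments can be read off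
(\<open>edge_inner_affine\<close>). The tensors \<open>T\<close> and the corner tensors have no normal-normal trace, the \<open>T\<close>
vanish at the vertices, and the corner tensors and the uncorrected \<open>N\<close> have constant tangential
traces. Hence subtracting multiples of \<open>T\<^sub>(\<^sub>l\<^sub>,\<^sub>0\<^sub>)\<close> and \<open>J\<^sub>l\<close> removes the unwanted functionals one
after the other and creates no new ones, which is the whole content of \<open>dof_basis_tensor\<close>.

Duality gives the linear independence of 15 tensors. They lie in the tensor space, which is spanned by
15 explicit fields (\<open>XX_subset_span_generators\<close>), so they form a basis.

For the norms no transformation to the reference triangle is made. On triangles of bounded
shape-regularity, \<open>h\<^sup>2 / D\<close> is bounded, where \<open>h\<close> is the diameter. Written in terms of \<open>h\<^sup>2 / D\<close>,
\<open>\<eta>\<^sub>j\<close>, \<open>(x - z\<^sub>j) / h\<close> and \<open>e\<^sub>j / h\<close>, every basis tensor is therefore bounded by a constant \<open>C\<close> and has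
a Lipschitz constant at most \<open>C / h\<close> (\<open>tame_basis_tensor\<close>). The bound gives the upper estimate.
For the lower one, every basis tensor has norm at least some \<open>c > 0\<close> at a suitable point: \<open>N\<close> at a
vertex because its normal-normal trace there is \<open>1\<close>, \<open>J\<close> at a vertex because of its jump \<open>1\<close>, and
\<open>T\<close> at the midpoint of an edge (\<open>basis_tensor_large_somewhere\<close>). By the Lipschitz estimate the norm stays above \<open>c / 2\<close> on a copy of the triangle shrunk towards that point by
a fixed factor, and this copy contains a disc whose radius is a fixed multiple of \<open>h\<close>
(\<open>L2_norm_lower_bound\<close>).\<close>

section \<open>Symmetric products and cyclic indices\<close>

text \<open>Edges and vertices are named relative to a given one, as \<open>j\<close>, \<open>j + 1\<close> and \<open>j + 2\<close>, so that each computation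
is done once instead of for three concrete indices.\<close>

lemma index_shift:
  fixes j :: 3
  shows "j + 1 + 1 = j + 2" "j + 1 + 2 = j" "j + 2 + 1 = j" "j + 2 + 2 = j + 1" "j - 1 = j + 2"
    "j + 3 = j" "j + 4 = j + 1"
    "j + 1 \<noteq> j" "j + 2 \<noteq> j" "j + 1 \<noteq> j + 2" "j \<noteq> j + 1" "j \<noteq> j + 2" "j + 2 \<noteq> j + 1"
  using exhaust_3[of j] by auto

lemma cyclic_cases:
  fixes j l :: 3
  obtains "l = j" | "l = j + 1" | "l = j + 2"
  using exhaust_3[of j] exhaust_3[of l] by auto

lemma sum_cyclic: "(\<Sum>l\<in>UNIV. f l) = f j + f (j + 1) + f (j + 2)"
  for j :: 3 and f :: "3 \<Rightarrow> 'a::comm_monoid_add"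
  using exhaust_3[of j] by (elim disjE) (simp_all only: sum_3 three_cyclic, simp_all add: ac_simps)

definition edge :: "vertices \<Rightarrow> 3 \<Rightarrow> real^2"
  where "edge z j = z (j + 1) - z j"

definition len :: "vertices \<Rightarrow> 3 \<Rightarrow> real"
  where "len z j = dist (z j) (z (j + 1))"

abbreviation area2 :: "vertices \<Rightarrow> real" where "area2 z \<equiv> det (BK z)"

definition sym_prod :: "real^2 \<Rightarrow> real^2 \<Rightarrow> real^2^2"  (infixl "\<odot>" 75)
  where "u \<odot> v = sym_part (outer u v)"

lemma sym_prod_nth: "(u \<odot> v) $ a $ b = (u $ a * v $ b + u $ b * v $ a) / 2"
  by (simp add: sym_prod_def sym_part_def outer_def transpose_def)

lemma norm_outer: "norm (outer u v) = norm u * norm v"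
proof -
  have "norm (outer u v) = L2_set (\<lambda>a. \<bar>u $ a\<bar> * norm v) UNIV"
  proof -
    have "outer u v $ a = (u $ a) *\<^sub>R v" for a
      by (simp add: outer_def vec_eq_iff)
    then show ?thesis by (simp add: norm_vec_def[of "outer u v"])
  qed
  also have "\<dots> = norm u * norm v"
    using L2_set_left_distrib[of "norm v" "\<lambda>a. \<bar>u $ a\<bar>" UNIV] by (simp add: norm_vec_def[of u])
  finally show ?thesis .
qed

lemma norm_sym_prod_le: "norm (u \<odot> v) \<le> norm u * norm v"
proof -
  have "u \<odot> v = (1/2) *\<^sub>R (outer u v + outer v u)"
    by (simp add: vec_eq_iff sym_prod_nth outer_def)
  also have "norm \<dots> \<le> (1/2) * (norm (outer u v) + norm (outer v u))"
    using norm_triangle_ineq[of "outer u v" "outer v u"] by simp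
  finally show ?thesis by (simp add: norm_outer)
qed

lemma sym_prod_self: "u \<odot> u = outer u u"
  by (simp add: vec_eq_iff sym_prod_nth outer_def)

lemma bounded_bilinear_sym_prod: "bounded_bilinear (\<odot>)"
proof
  show "\<exists>K. \<forall>a b. norm (a \<odot> b) \<le> norm a * norm b * K"
    using norm_sym_prod_le by (metis mult.right_neutral)
qed (simp_all add: vec_eq_iff sym_prod_nth field_simps)

lemmas sym_prod_bilinear = bounded_bilinear.add_left[OF bounded_bilinear_sym_prod] bounded_bilinear.add_right[OF bounded_bilinear_sym_prod]
  bounded_bilinear.diff_left[OF bounded_bilinear_sym_prod] bounded_bilinear.diff_right[OF bounded_bilinear_sym_prod]
  bounded_bilinear.scaleR_left[OF bounded_bilinear_sym_prod] bounded_bilinear.scaleR_right[OF bounded_bilinear_sym_prod]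
  bounded_bilinear.minus_left[OF bounded_bilinear_sym_prod] bounded_bilinear.minus_right[OF bounded_bilinear_sym_prod]

lemma inner_mult_sym_prod: "p \<bullet> ((u \<odot> v) *v q) = ((p \<bullet> u) * (v \<bullet> q) + (p \<bullet> v) * (u \<bullet> q)) / 2"
  by (simp add: inner_vec_def matrix_vector_mult_def sum_2 sym_prod_nth field_simps)

lemma inner_matrix_linear:
  "p \<bullet> ((c *\<^sub>R M) *v q) = c * (p \<bullet> (M *v q))"
  "p \<bullet> ((M + N) *v q) = p \<bullet> (M *v q) + p \<bullet> (N *v q)"
  "p \<bullet> ((M - N) *v q) = p \<bullet> (M *v q) - p \<bullet> (N *v q)"
  for M N :: "real^2^2"
  by (simp_all add: inner_vec_def matrix_vector_mult_def sum_2 algebra_simps)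

section \<open>Edges and barycentric coordinates\<close>

lemma len_pos: "pos_triangle z \<Longrightarrow> len z j > 0"
  using pos_triangle_edge by (simp add: len_def)

lemma edge_tang: "pos_triangle z \<Longrightarrow> edge z j = len z j *\<^sub>R tang z j"
  using len_pos[of z j] by (simp add: edge_def tang_def len_def)

lemma tang_edge: "tang z j = (1 / len z j) *\<^sub>R edge z j"
  by (simp add: tang_def edge_def len_def)

lemma nrml_inner: "nrml z j \<bullet> v = cross2 v (edge z j) / len z j"
  by (simp add: nrml_def inner_vec_def sum_2 tang_edge cross2_def diff_divide_distrib mult.commute)

lemma cross2_edges:
  "cross2 (edge z (j + 2)) (edge z j) = area2 z" "cross2 (edge z (j + 1)) (edge z j) = - area2 z"
  "cross2 (edge z j) (edge z j) = 0"
proof -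
  have "cross2 (a - c) (b - a) = cross2 (b - a) (c - a)"
    "cross2 (c - b) (b - a) = - cross2 (b - a) (c - a)" "cross2 a a = 0" for a b c
    by (simp_all add: cross2_def algebra_simps)
  then show "cross2 (edge z (j + 2)) (edge z j) = area2 z"
    "cross2 (edge z (j + 1)) (edge z j) = - area2 z" "cross2 (edge z j) (edge z j) = 0"
    by (simp_all only: edge_def index_shift det_BK_cyclic[of z j])
qed

lemma nrml_edge:
  "nrml z j \<bullet> edge z (j + 2) = area2 z / len z j" "nrml z j \<bullet> edge z (j + 1) = - area2 z / len z j"
  "nrml z j \<bullet> edge z j = 0"
  by (simp_all add: nrml_inner cross2_edges)

lemma frame_orthonormal:
  assumes "pos_triangle z"
  shows "nrml z j \<bullet> nrml z j = 1" "tang z j \<bullet> tang z j = 1" "nrml z j \<bullet> tang z j = 0" "tang z j \<bullet> nrml z j = 0"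
  using nrml_exterior[OF assms, of j] by (simp_all add: norm_eq_1 inner_commute)

text \<open>The edge is parametrised by arc length, as in the integrals over edges.\<close>

definition edge_at :: "vertices \<Rightarrow> 3 \<Rightarrow> real \<Rightarrow> real^2"
  where "edge_at z j s = z j + s *\<^sub>R tang z j"

lemma edge_at_diff:
  assumes "pos_triangle z"
  shows "edge_at z j s - z j = s *\<^sub>R tang z j"
    "edge_at z j s - z (j + 1) = (s - len z j) *\<^sub>R tang z j"
    "edge_at z j s - z (j + 2) = edge z (j + 2) + s *\<^sub>R tang z j"
proof -
  have "edge_at z j s - z (j + 1) = s *\<^sub>R tang z j - edge z j"
    by (simp add: edge_at_def edge_def)
  then show "edge_at z j s - z (j + 1) = (s - len z j) *\<^sub>R tang z j"
    by (simp add: edge_tang[OF assms] scaleR_left_diff_distrib)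
qed (simp_all add: edge_at_def edge_def index_shift)

text \<open>The gradient of the affine function \<open>bary z j\<close>, as a linear form.\<close>

definition dbary :: "vertices \<Rightarrow> 3 \<Rightarrow> real^2 \<Rightarrow> real"
  where "dbary z j h = - cross2 h (edge z (j + 1)) / area2 z"

lemma bounded_bilinear_cross2: "bounded_bilinear cross2"
proof
  show "\<exists>K. \<forall>a b. norm (cross2 a b) \<le> norm a * norm b * K"
  proof (intro exI allI)
    fix a b :: "real^2"
    have "norm (cross2 a b) \<le> norm (a$1) * norm (b$2) + norm (a$2) * norm (b$1)"
      unfolding cross2_def by (metis norm_mult norm_triangle_ineq4)
    also have "\<dots> \<le> norm a * norm b + norm a * norm b"
      by (intro add_mono mult_mono) (auto simp: component_le_norm_cart)
    finally show "norm (cross2 a b) \<le> norm a * norm b * 2" by simp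
  qed
qed (simp_all add: cross2_def algebra_simps)

lemma bary_diff: "bary z j x' - bary z j x = dbary z j (x' - x)"
proof -
  have "cross2 (b - x') (c - x') - cross2 (b - x) (c - x) = - cross2 (x' - x) (c - b)" for b c
    by (simp add: cross2_def algebra_simps)
  then show ?thesis
    by (simp only: bary_def dbary_def edge_def index_shift diff_divide_distrib[symmetric])
qed

lemma linear_dbary: "bounded_linear (dbary z j)"
proof -
  have "dbary z j = (\<lambda>h. cross2 h (edge z (j + 1)) * (- 1 / area2 z))"
    by (simp add: fun_eq_iff dbary_def)
  then show ?thesis
    by (simp only: bounded_linear_mult_const[OF bounded_bilinear.bounded_linear_left[OF bounded_bilinear_cross2]])
qed

lemma bary_has_derivative [derivative_intros]: "(bary z j has_derivative dbary z j) F"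
proof -
  have "bary z j = (\<lambda>x. bary z j 0 + dbary z j x)"
  proof
    show "bary z j x = bary z j 0 + dbary z j x" for x
      using bary_diff[of z j x 0] by (simp only: diff_zero diff_eq_eq add.commute)
  qed
  then show ?thesis
    using has_derivative_add[OF has_derivative_const[of "bary z j 0"]
        bounded_linear_imp_has_derivative[OF linear_dbary[of z j]], of F] by simp
qed

text \<open>On edge \<open>j\<close> the coordinates \<open>\<eta>\<^sub>j\<close> and \<open>\<eta>\<^sub>j\<^sub>+\<^sub>1\<close> exchange the values \<open>0\<close> and \<open>1\<close>, while
\<open>\<eta>\<^sub>j\<^sub>+\<^sub>2\<close> vanishes there and falls off from \<open>1\<close> at the opposite vertex, over the height of the triangle. The
normal derivatives of the other two coordinates depend on the angles of the triangle.\<close>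

lemma dbary_frame:
  assumes "pos_triangle z"
  shows "dbary z j (tang z j) = - 1 / len z j" "dbary z (j + 1) (tang z j) = 1 / len z j"
   "dbary z (j + 2) (tang z j) = 0" "dbary z (j + 2) (nrml z j) = - len z j / area2 z"
proof -
  have L: "len z j > 0" and D: "area2 z > 0"
    using len_pos[OF assms] assms by (simp_all add: pos_triangle_def)
  have t: "tang z j = (1 / len z j) *\<^sub>R edge z j"
    by (simp add: tang_def edge_def len_def)
  have c: "cross2 (tang z j) v = cross2 (edge z j) v / len z j" for v
    by (simp add: t cross2_def diff_divide_distrib)
  have a: "cross2 u v = - cross2 v u" for u v
    by (simp add: cross2_def)
  show "dbary z j (tang z j) = - 1 / len z j" "dbary z (j + 1) (tang z j) = 1 / len z j"
   "dbary z (j + 2) (tang z j) = 0"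
    using L D cross2_edges[of z j] a[of "edge z j" "edge z (j + 1)"] a[of "edge z j" "edge z (j + 2)"] by (simp_all add: dbary_def index_shift c)
  have "cross2 (nrml z j) (edge z j) = len z j * (nrml z j \<bullet> nrml z j)"
    using L by (simp add: nrml_inner)
  then show "dbary z (j + 2) (nrml z j) = - len z j / area2 z"
    using frame_orthonormal[OF assms] by (simp add: dbary_def index_shift)
qed

lemma bary_edge_at:
  assumes "pos_triangle z"
  shows "bary z j (edge_at z j s) = 1 - s / len z j" "bary z (j + 1) (edge_at z j s) = s / len z j"
    "bary z (j + 2) (edge_at z j s) = 0"
proof -
  have "bary z k (edge_at z j s) = bary z k (z j) + s * dbary z k (tang z j)" for k
    using bary_diff[of z k "edge_at z j s" "z j"]
    by (simp add: edge_at_diff[OF assms] linear_scale[OF bounded_linear.linear[OF linear_dbary]])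
  then show "bary z j (edge_at z j s) = 1 - s / len z j" "bary z (j + 1) (edge_at z j s) = s / len z j"
    "bary z (j + 2) (edge_at z j s) = 0"
    using dbary_frame[OF assms, of j] by (simp_all add: bary_vertex[OF assms] index_shift)
qed

section \<open>Traces of differentiable tensor fields\<close>

lemma component_has_derivative:
  fixes M :: tensor_field
  assumes "(M has_derivative M') F"
  shows "((\<lambda>y. M y $ a $ b) has_derivative (\<lambda>h. M' h $ a $ b)) F"
  by (rule bounded_linear.has_derivative[OF bounded_linear_vec_nth[of b],
        OF bounded_linear.has_derivative[OF bounded_linear_vec_nth[of a] assms]])

lemma Div_eq:
  assumes "(M has_derivative M') (at x)"
  shows "Div M x $ a = (\<Sum>b\<in>UNIV. M' (axis b 1) $ a $ b)"
  using frechet_derivative_at[OF component_has_derivative[OF assms], symmetric] by (simp add: Div_def)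

lemma tr_tn_has_derivative:
  assumes "(M has_derivative M') (at x)"
  shows "(tr_tn z j M has_derivative (\<lambda>h. tang z j \<bullet> (M' h *v nrml z j))) (at x)"
proof -
  have "linear (\<lambda>A. tang z j \<bullet> (A *v nrml z j))"
    by (rule linearI) (simp_all only: inner_matrix_linear real_scaleR_def)
  then have "bounded_linear (\<lambda>A. tang z j \<bullet> (A *v nrml z j))"
    by (simp only: linear_conv_bounded_linear)
  then show ?thesis
    unfolding tr_tn_def[abs_def] by (rule bounded_linear.has_derivative[OF _ assms])
qed

text \<open>The divergence is the trace of the derivative, and the trace can be taken in the orthonormal frame
\<open>(t, n)\<close> of the edge instead of the coordinate axes. This reduces the tangential trace to frame
components of \<open>M'\<close>.\<close>

lemma tr_t_eq:
  fixes z :: vertices and j :: 3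
  assumes z: "pos_triangle z" and M: "(M has_derivative M') (at x)"
  defines "t \<equiv> tang z j" and "n \<equiv> nrml z j"
  shows "tr_t z j M x = n \<bullet> (M' t *v t) + n \<bullet> (M' n *v n) + t \<bullet> (M' t *v n)"
proof -
  have n: "n $ 1 = t $ 2" "n $ 2 = - t $ 1"
    by (simp_all add: n_def nrml_def t_def)
  have o: "t $ 2 * t $ 2 = 1 - t $ 1 * t $ 1"
    using frame_orthonormal(2)[OF z, of j] by (simp add: t_def inner_vec_def sum_2)
  have l: "linear M'" by (rule has_derivative_linear[OF M])
  have ex: "M' h = h $ 1 *\<^sub>R M' (axis 1 1) + h $ 2 *\<^sub>R M' (axis 2 1)" for h
  proof -
    have "h $ 1 *\<^sub>R axis 1 1 + h $ 2 *\<^sub>R axis 2 1 = h"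
      by (simp add: vec_eq_iff forall_2 axis_def)
    then have "M' h = M' (h $ 1 *\<^sub>R axis 1 1 + h $ 2 *\<^sub>R axis 2 1)"
      by (rule arg_cong[symmetric])
    then show ?thesis
      by (simp only: linear_add[OF l] linear_scale[OF l])
  qed
  have "(M' t *v t + M' n *v n) $ a = Div M x $ a" for a
  proof -
    have "(M' t *v t + M' n *v n) $ a
        = (t $ 1 * t $ 1 + t $ 2 * t $ 2) * (M' (axis 1 1) $ a $ 1 + M' (axis 2 1) $ a $ 2)"
      by (simp add: matrix_vector_mult_def sum_2 ex[of t] ex[of n] n algebra_simps)
    then show ?thesis
      unfolding Div_eq[OF M] by (simp add: sum_2 o)
  qed
  then have "Div M x = M' t *v t + M' n *v n"
    by (simp add: vec_eq_iff)
  then have "n \<bullet> Div M x = n \<bullet> (M' t *v t) + n \<bullet> (M' n *v n)"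
    by (simp add: inner_add_right)
  moreover have "frechet_derivative (tr_tn z j M) (at x) t = t \<bullet> (M' t *v n)"
    using frechet_derivative_at[OF tr_tn_has_derivative[OF M], symmetric] by (simp add: t_def n_def)
  ultimately show ?thesis
    by (simp add: tr_t_def t_def n_def)
qed

section \<open>Linearity of the degrees of freedom\<close>

text \<open>The degrees of freedom involve derivatives and integrals, both of which are total functions with
arbitrary values outside their domains. On this space they are genuinely linear.\<close>

definition smooth_tensors :: "tensor_field set"
  where "smooth_tensors = {M. \<exists>M'. (\<forall>x. (M has_derivative M' x) (at x)) \<and> (\<forall>h. continuous_on UNIV (\<lambda>x. M' x h))}"

lemma smooth_tensorsI:
  assumes "\<And>x. (M has_derivative M' x) (at x)" "\<And>h. continuous_on UNIV (\<lambda>x. M' x h)"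
  shows "M \<in> smooth_tensors"
  using assms by (auto simp: smooth_tensors_def)

lemma has_derivative_combination:
  assumes "(M has_derivative M') (at x)" "(N has_derivative N') (at x)"
  shows "((M + c *\<^sub>R N) has_derivative (\<lambda>h. M' h + c *\<^sub>R N' h)) (at x)"
proof -
  have "M + c *\<^sub>R N = (\<lambda>x. M x + c *\<^sub>R N x)"
    by (simp add: fun_eq_iff)
  then show ?thesis
    using assms by (auto intro!: derivative_eq_intros)
qed

lemma subspace_smooth_tensors: "subspace smooth_tensors"
proof -
  have comb: "M + c *\<^sub>R N \<in> smooth_tensors" if "M \<in> smooth_tensors" "N \<in> smooth_tensors" for M N c
  proof -
    from that obtain M' N' where "\<And>x. (M has_derivative M' x) (at x)" "\<And>h. continuous_on UNIV (\<lambda>x. M' x h)"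
      "\<And>x. (N has_derivative N' x) (at x)" "\<And>h. continuous_on UNIV (\<lambda>x. N' x h)"
      unfolding smooth_tensors_def by blast
    then show ?thesis
      by (intro smooth_tensorsI[where M' = "\<lambda>x h. M' x h + c *\<^sub>R N' x h"] has_derivative_combination)
        (auto intro!: continuous_intros)
  qed
  have z: "0 \<in> smooth_tensors"
    by (rule smooth_tensorsI[where M' = "\<lambda>x h. 0"]) (simp_all add: zero_fun_def)
  show ?thesis
    using comb[of _ _ 1] comb[OF z] z by (auto simp: subspace_def)
qed

lemma tr_n_combination: "tr_n z l (M + c *\<^sub>R N) x = tr_n z l M x + c * tr_n z l N x"
  by (simp add: tr_n_def inner_matrix_linear)

lemma tr_tn_combination: "tr_tn z l (M + c *\<^sub>R N) x = tr_tn z l M x + c * tr_tn z l N x"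
  by (simp add: tr_tn_def inner_matrix_linear)

lemma jump_combination: "jump z l (M + c *\<^sub>R N) = jump z l M + c * jump z l N"
  by (simp add: jump_def tr_tn_combination right_diff_distrib)

lemma tr_t_combination:
  assumes "pos_triangle z" "M \<in> smooth_tensors" "N \<in> smooth_tensors"
  shows "tr_t z l (M + c *\<^sub>R N) x = tr_t z l M x + c * tr_t z l N x"
proof -
  from assms obtain M' N' where d: "(M has_derivative M' x) (at x)" "(N has_derivative N' x) (at x)"
    unfolding smooth_tensors_def by blast
  show ?thesis
    unfolding tr_t_eq[OF assms(1) d(1)] tr_t_eq[OF assms(1) d(2)]
      tr_t_eq[OF assms(1) has_derivative_combination[OF d]]
    by (simp add: inner_matrix_linear algebra_simps)
qed

lemma continuous_inner_matrix:
  fixes f :: "'a::t2_space \<Rightarrow> real^2^2"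
  assumes "continuous_on S f"
  shows "continuous_on S (\<lambda>x. p \<bullet> (f x *v q))"
  using assms unfolding inner_vec_def matrix_vector_mult_def sum_2
  by (auto intro!: continuous_intros)

lemma smooth_tensors_continuous:
  assumes "M \<in> smooth_tensors"
  shows "continuous_on S M"
proof -
  from assms obtain M' where d: "\<And>x. (M has_derivative M' x) (at x)"
    unfolding smooth_tensors_def by blast
  show ?thesis
    by (intro continuous_at_imp_continuous_on ballI has_derivative_continuous[OF d])
qed

lemma continuous_tr_n:
  assumes "M \<in> smooth_tensors"
  shows "continuous_on S (tr_n z l M)"
  unfolding tr_n_def[abs_def] by (intro continuous_inner_matrix smooth_tensors_continuous assms)

lemma continuous_tr_t:
  assumes "pos_triangle z" "M \<in> smooth_tensors"
  shows "continuous_on S (tr_t z l M)"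
proof -
  from assms obtain M' where d: "\<And>x. (M has_derivative M' x) (at x)"
     and c: "\<And>h. continuous_on UNIV (\<lambda>x. M' x h)"
    unfolding smooth_tensors_def by blast
  have "continuous_on UNIV (tr_t z l M)"
    unfolding tr_t_eq[OF assms(1) d, abs_def]
    by (intro continuous_intros continuous_inner_matrix c)
  then show ?thesis using continuous_on_subset by blast
qed

lemma continuous_legendre [continuous_intros]: "continuous_on S (legendre k)"
proof (induction k rule: induct_nat_012)
  case 0
  then show ?case by (simp add: continuous_on_const)
next
  case 1
  have "legendre (Suc 0) = (\<lambda>s. s)" by auto
  then show ?case by simp
next
  case (ge2 n)
  have "legendre (Suc (Suc n)) = (\<lambda>s.
       ((2 * real n + 3) * s * legendre (Suc n) s - (real n + 1) * legendre n s) / (real n + 2))"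
    by auto
  then show ?case using ge2 by (simp only:) (auto intro!: continuous_intros)
qed

lemma continuous_edge_legendre: "continuous_on S (edge_legendre z l k)"
proof -
  have "continuous_on S (\<lambda>x. legendre k (2 * ((x - z l) \<bullet> tang z l) / dist (z l) (z (l + 1)) - 1))"
    by (rule continuous_on_compose2[OF continuous_legendre[of UNIV]])
      (auto intro!: continuous_intros simp: divide_inverse)
  then show ?thesis by (simp add: edge_legendre_def[abs_def])
qed

lemma edge_inner_combination:
  assumes "continuous_on UNIV f" "continuous_on UNIV g" "continuous_on UNIV q"
  shows "edge_inner z l (\<lambda>x. f x + c * g x) q = edge_inner z l f q + c * edge_inner z l g q"
proof -
  have 1: "(\<lambda>s. h (z l + s *\<^sub>R tang z l) * q (z l + s *\<^sub>R tang z l)) integrable_on {0..dist (z l) (z (l + 1))}"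
    if "continuous_on UNIV h" for h
    by (intro integrable_continuous_interval continuous_intros continuous_on_compose2[OF that]
       continuous_on_compose2[OF assms(3)]) auto
  show ?thesis
    using integral_add[OF 1[OF assms(1)] integrable_on_cmult_left[OF 1[OF assms(2)], of c]]
    by (simp add: edge_inner_def algebra_simps)
qed

text \<open>One law for \<open>M + c N\<close> covers sums, differences and scalar multiples.\<close>

lemma dof_combination:
  assumes z: "pos_triangle z" and MN: "M \<in> smooth_tensors" "N \<in> smooth_tensors"
  shows "dof z i (M + c *\<^sub>R N) = dof z i M + c * dof z i N"
proof (cases i)
  case (Nrm l m)
  have "tr_n z l (M + c *\<^sub>R N) = (\<lambda>x. tr_n z l M x + c * tr_n z l N x)"
    by (simp add: fun_eq_iff tr_n_combination)
  then show ?thesis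
    by (simp add: Nrm edge_inner_combination continuous_tr_n MN continuous_edge_legendre add_divide_distrib)
next
  case (Tan l m)
  have "tr_t z l (M + c *\<^sub>R N) = (\<lambda>x. tr_t z l M x + c * tr_t z l N x)"
    by (simp add: fun_eq_iff tr_t_combination z MN)
  then show ?thesis
    by (simp add: Tan edge_inner_combination continuous_tr_t z MN continuous_edge_legendre)
next
  case (Jmp l)
  then show ?thesis by (simp add: jump_combination)
qed

lemma dof_zero:
  assumes "pos_triangle z"
  shows "dof z i 0 = 0"
  using dof_combination[OF assms subspace_0[OF subspace_smooth_tensors] subspace_0[OF subspace_smooth_tensors], of i 1]
  by simp

lemma dof_linear:
  assumes "pos_triangle z" "M \<in> smooth_tensors" "N \<in> smooth_tensors"
  shows "dof z i (M + N) = dof z i M + dof z i N" "dof z i (M - N) = dof z i M - dof z i N"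
    "dof z i (c *\<^sub>R M) = c * dof z i M"
  using dof_combination[OF assms, of i 1] dof_combination[OF assms, of i "-1"]
    dof_combination[OF assms(1) subspace_0[OF subspace_smooth_tensors] assms(2), of i c] dof_zero[OF assms(1), of i]
  by simp_all

lemma dof_sum:
  assumes "pos_triangle z" "\<And>k. k \<in> A \<Longrightarrow> M k \<in> smooth_tensors"
  shows "dof z i (\<Sum>k\<in>A. c k *\<^sub>R M k) = (\<Sum>k\<in>A. c k * dof z i (M k))"
  using assms(2)
proof (induction A rule: infinite_finite_induct)
  case (insert k A)
  then have "(\<Sum>k\<in>A. c k *\<^sub>R M k) \<in> smooth_tensors"  "c k *\<^sub>R M k \<in> smooth_tensors"
    using subspace_smooth_tensors by (auto intro!: subspace_sum subspace_scale)
  note add = dof_linear(1)[OF assms(1) this(2,1)]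
  have scale: "dof z i (c k *\<^sub>R M k) = c k * dof z i (M k)"
    using insert.prems by (intro dof_linear(3)[OF assms(1)]) auto
  have IH: "dof z i (\<Sum>k\<in>A. c k *\<^sub>R M k) = (\<Sum>k\<in>A. c k * dof z i (M k))"
    using insert.prems by (intro insert.IH) auto
  show ?case
    by (simp only: sum.insert[OF insert.hyps] add scale IH)
qed (simp_all add: dof_zero assms)

section \<open>Moments of affine traces\<close>

lemma edge_inner_eq:
  "edge_inner z l f g = integral {0..len z l} (\<lambda>s. f (edge_at z l s) * g (edge_at z l s))"
  by (simp add: edge_inner_def edge_at_def len_def)

text \<open>For \<open>a + b \<tau>\<close> on the unit interval, the mean is \<open>a + b / 2\<close> and the moment against
\<open>2 \<tau> - 1\<close> is \<open>b / 6\<close>. This is the only integration that duality requires.\<close>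

lemma edge_inner_affine:
  assumes z: "pos_triangle z"
    and f: "\<And>s. f (edge_at z l s) = a + b * (s / len z l)"
  shows "edge_inner z l f (\<lambda>x. 1) = len z l * (a + b / 2)"
    "edge_inner z l f (edge_legendre z l 1) = len z l * b / 6"
proof -
  let ?L = "len z l"
  have L: "?L > 0" by (rule len_pos[OF z])
  have "((\<lambda>s. a + b * (s / ?L)) has_integral (a * ?L + b * ?L\<^sup>2 / (2 * ?L)) - (a * 0 + b * 0\<^sup>2 / (2 * ?L))) {0..?L}"
    using L by (intro fundamental_theorem_of_calculus)
      (auto intro!: derivative_eq_intros simp: has_real_derivative_iff_has_vector_derivative[symmetric] field_simps)
  then show "edge_inner z l f (\<lambda>x. 1) = ?L * (a + b / 2)"
    using L by (simp add: edge_inner_eq f integral_unique power2_eq_square algebra_simps)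
  have leg: "edge_legendre z l 1 (edge_at z l s) = 2 * s / ?L - 1" for s
    using frame_orthonormal[OF z, of l] by (simp add: edge_legendre_def edge_at_diff[OF z] len_def[symmetric])
  \<comment> \<open>an antiderivative of the product, expanded in powers of \<open>s\<close>\<close>
  have "((\<lambda>s. (a + b * (s / ?L)) * (2 * s / ?L - 1)) has_integral
     (- a * ?L + (2 * a - b) * ?L\<^sup>2 / (2 * ?L) + 2 * b * ?L^3 / (3 * ?L\<^sup>2)) -
     (- a * 0 + (2 * a - b) * 0\<^sup>2 / (2 * ?L) + 2 * b * 0^3 / (3 * ?L\<^sup>2))) {0..?L}"
    using L by (intro fundamental_theorem_of_calculus)
      (auto intro!: derivative_eq_intros simp: has_real_derivative_iff_has_vector_derivative[symmetric] field_simps power2_eq_square)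
  moreover have "(- a * ?L + (2 * a - b) * ?L\<^sup>2 / (2 * ?L) + 2 * b * ?L^3 / (3 * ?L\<^sup>2)) -
     (- a * 0 + (2 * a - b) * 0\<^sup>2 / (2 * ?L) + 2 * b * 0^3 / (3 * ?L\<^sup>2)) = ?L * b / 6"
    using L by (simp add: field_simps power2_eq_square power3_eq_cube)
  ultimately show "edge_inner z l f (edge_legendre z l 1) = ?L * b / 6"
    by (simp add: edge_inner_eq f leg integral_unique del: One_nat_def)
qed

lemma edge_legendre_0: "edge_legendre z l 0 = (\<lambda>x. 1)"
  by (simp add: edge_legendre_def fun_eq_iff)

lemma edge_norm_legendre:
  assumes z: "pos_triangle z"
  shows "(edge_norm z l (\<lambda>x. 1))\<^sup>2 = len z l"
    "(edge_norm z l (edge_legendre z l 1))\<^sup>2 = len z l / 3"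
proof -
  have L: "len z l > 0" by (rule len_pos[OF z])
  show "(edge_norm z l (\<lambda>x. 1))\<^sup>2 = len z l"
    using edge_inner_affine(1)[OF z, of "\<lambda>x. 1" l 1 0] L by (simp add: edge_norm_def edge_legendre_0)
  have "edge_legendre z l 1 (edge_at z l s) = -1 + 2 * (s / len z l)" for s
    using frame_orthonormal[OF z, of l] by (simp add: edge_legendre_def edge_at_diff[OF z] len_def[symmetric])
  from edge_inner_affine(2)[OF z this]
  show "(edge_norm z l (edge_legendre z l 1))\<^sup>2 = len z l / 3"
    using L by (simp add: edge_norm_def)
qed

lemma dof_Nrm_affine:
  assumes z: "pos_triangle z" and f: "\<And>s. tr_n z l M (edge_at z l s) = a + b * (s / len z l)"
  shows "dof z (Nrm l 0) M = a + b / 2" "dof z (Nrm l 1) M = b / 2"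
proof -
  have L: "len z l > 0" by (rule len_pos[OF z])
  show "dof z (Nrm l 0) M = a + b / 2"
    using L by (simp only: dof.simps edge_legendre_0 edge_norm_legendre[OF z] edge_inner_affine[OF z f]) simp
  show "dof z (Nrm l 1) M = b / 2"
    using L by (simp only: dof.simps edge_norm_legendre[OF z] edge_inner_affine[OF z f]) simp
qed

lemma dof_Tan_affine:
  assumes z: "pos_triangle z" and f: "\<And>s. tr_t z l M (edge_at z l s) = a + b * (s / len z l)"
  shows "dof z (Tan l 0) M = len z l * (a + b / 2)" "dof z (Tan l 1) M = len z l * b / 6"
  using edge_inner_affine[OF z f] by (simp_all add: edge_legendre_0 del: One_nat_def)

section \<open>Intrinsic formulas for the tensors\<close>

lemma area2_pos: "pos_triangle z \<Longrightarrow> area2 z > 0"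
  by (simp add: pos_triangle_def)

lemma area2_ref: "area2 ref_triangle = 1"
  by (simp add: det_2 BK_nth ref_triangle_def axis_def)

lemma FK_diff: "FK z p - z k = BK z *v (p - ref_triangle k)"
proof -
  have "FK z p - FK z (ref_triangle k) = BK z *v (p - ref_triangle k)"
    by (simp add: FK_def matrix_vector_mult_diff_distrib)
  then show ?thesis by (simp add: FK_vertices)
qed

lemma BK_edge: "BK z *v edge ref_triangle j = edge z j"
  using FK_diff[of z "ref_triangle (j + 1)" j] by (simp add: edge_def FK_vertices)

lemma cross2_mult: "cross2 (A *v u) (A *v v) = det A * cross2 u v"
  by (simp add: cross2_def matrix_vector_mult_def sum_2 det_2 algebra_simps)

text \<open>Both sides are quotients of areas, and the affine map multiplies all areas by \<open>det (BK z)\<close>.\<close>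

lemma bary_FK:
  assumes "pos_triangle z"
  shows "bary z j (FK z p) = bary ref_triangle j p"
proof -
  have "z k - FK z p = BK z *v (ref_triangle k - p)" for k
    using FK_diff[of z p k] by (simp add: matrix_vector_mult_diff_distrib algebra_simps)
  then show ?thesis
    using area2_pos[OF assms] by (simp add: bary_def cross2_mult area2_ref)
qed

lemma bij_FK:
  assumes "pos_triangle z"
  shows "bij (FK z)"
proof -
  have "bij ((*v) (BK z))"
    using assms by (simp add: pos_triangle_def invertible_eq_bij[symmetric] invertible_det_nz)
  moreover have "FK z = (\<lambda>v. v + z 1) \<circ> (*v) (BK z)"
    by (simp add: FK_def fun_eq_iff)
  moreover have "bij (\<lambda>v. v + z 1)"
    by (rule bij_plus_right)
  ultimately show ?thesis
    using bij_comp by metis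
qed

text \<open>The inverse of the affine map in the definition of the transformation is avoided by parametrising
the plane by the reference coordinates.\<close>

lemma piola_eqI:
  assumes "pos_triangle z"
    and "\<And>p. N (FK z p) = (1 / area2 z) *\<^sub>R (BK z ** M p ** transpose (BK z))"
  shows "piola z M = N"
proof
  fix x
  obtain p where "x = FK z p"
    using bij_FK[OF assms(1)] by (metis bij_pointE)
  then show "piola z M x = N x"
    using bij_is_inj[OF bij_FK[OF assms(1)]] by (simp add: piola_def assms(2))
qed

lemma congruence_sym_prod: "A ** (u \<odot> v) ** transpose A = (A *v u) \<odot> (A *v v)"
  by (simp add: vec_eq_iff forall_2 matrix_matrix_mult_def transpose_def matrix_vector_mult_def sum_2 sym_prod_nth field_simps)

lemma congruence_linear:
  "A ** (c *\<^sub>R M) ** transpose A = c *\<^sub>R (A ** M ** transpose A)"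
  "A ** (- M) ** transpose A = - (A ** M ** transpose A)"
  "A ** (M + N) ** transpose A = A ** M ** transpose A + A ** N ** transpose A"
  "A ** (M - N) ** transpose A = A ** M ** transpose A - A ** N ** transpose A"
  for A M N :: "real^2^2"
  by (simp_all add: vec_eq_iff forall_2 matrix_matrix_mult_def transpose_def sum_2 algebra_simps)

text \<open>The cubic coefficients factor through the position vectors from the vertices. This
exposes the cyclic symmetry and makes the transformation to \<open>K\<close> immediate.\<close>

lemma T_ref_0:
  "T_ref j 0 p = - bary ref_triangle (j + 2) p *\<^sub>R ((p - ref_triangle (j + 2)) \<odot> (p - ref_triangle (j + 2)))"
  using exhaust_3[of j]
  by (elim disjE) (simp_all only: three_cyclic bary_def area2_ref T_ref_def Let_def,
     simp_all add: vec_eq_iff forall_2 sym_tensor_def ref_triangle_def sym_prod_nth cross2_def axis_def power2_eq_square field_simps)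

lemma T_ref_1:
  "T_ref j 1 p = (p - ref_triangle (j + 2)) \<odot>
     (bary ref_triangle (j + 1) p *\<^sub>R (p - ref_triangle (j + 1)) - bary ref_triangle j p *\<^sub>R (p - ref_triangle j))"
  using exhaust_3[of j]
  by (elim disjE) (simp_all only: three_cyclic bary_def area2_ref T_ref_def Let_def,
     simp_all add: vec_eq_iff forall_2 sym_tensor_def ref_triangle_def sym_prod_nth cross2_def axis_def power2_eq_square field_simps)

lemma T_tri_0:
  assumes "pos_triangle z"
  shows "T_tri z j 0 = (\<lambda>x. - (bary z (j + 2) x / area2 z) *\<^sub>R ((x - z (j + 2)) \<odot> (x - z (j + 2))))"
  unfolding T_tri_def
  by (rule piola_eqI[OF assms]) (simp add: T_ref_0 congruence_linear congruence_sym_prod FK_diff bary_FK[OF assms])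

lemma T_tri_1:
  assumes "pos_triangle z"
  shows "T_tri z j 1 = (\<lambda>x. (1 / area2 z) *\<^sub>R ((x - z (j + 2)) \<odot>
     (bary z (j + 1) x *\<^sub>R (x - z (j + 1)) - bary z j x *\<^sub>R (x - z j))))"
  unfolding T_tri_def
  by (rule piola_eqI[OF assms])
    (simp add: T_ref_1[unfolded One_nat_def] congruence_linear congruence_sym_prod FK_diff bary_FK[OF assms]
     matrix_vector_mult_diff_distrib[of _ "_ *\<^sub>R _"] matrix_vector_mult_scaleR)

text \<open>The image on \<open>K\<close> of the uncorrected reference tensor \<open>J_pre j\<close>: it lives at the corner \<open>z j\<close> between the
edges \<open>j\<close> and \<open>j + 2\<close>.\<close>

definition corner_tensor :: "vertices \<Rightarrow> 3 \<Rightarrow> tensor_field"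
  where "corner_tensor z j = (\<lambda>x. - (bary z j x / area2 z) *\<^sub>R (edge z j \<odot> edge z (j + 2)))"

text \<open>The normalising constant contains \<open>t\<^sub>j \<bullet> n\<^sub>j\<^sub>+\<^sub>2 = - t\<^sub>j\<^sub>+\<^sub>2 \<bullet> n\<^sub>j\<close>, which is the negative of twice the area
divided by both lengths. It cancels the normalisation of the two tangents, so that no length is left.\<close>

lemma J_pre_eq: "J_pre j = corner_tensor ref_triangle j"
proof -
  let ?z = ref_triangle
  note L = len_pos[OF pos_triangle_ref, of j] len_pos[OF pos_triangle_ref, of "j + 2"]
  have c: "cross2 (a *\<^sub>R u) v = a * cross2 u v" "cross2 u v = - cross2 v u" for a u v
    by (simp_all add: cross2_def algebra_simps)
  have "tang ?z j \<bullet> nrml ?z (j + 2) = nrml ?z (j + 2) \<bullet> tang ?z j"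
    "tang ?z (j + 2) \<bullet> nrml ?z j = nrml ?z j \<bullet> tang ?z (j + 2)"
    by (rule inner_commute)+
  moreover have "cross2 (edge ?z j) (edge ?z (j + 2)) = - 1" "cross2 (edge ?z (j + 2)) (edge ?z j) = 1"
    using cross2_edges[of ?z j] c(2)[of "edge ?z j" "edge ?z (j + 2)"] by (simp_all add: area2_ref)
  ultimately have "2 / (tang ?z j \<bullet> nrml ?z (j + 2) - tang ?z (j + 2) \<bullet> nrml ?z j) = - (len ?z j * len ?z (j + 2))"
    using L by (simp add: nrml_inner tang_edge c(1) field_simps)
  then show ?thesis
    using L unfolding J_pre_def corner_tensor_def sym_prod_def[symmetric] Let_def
    by (simp add: fun_eq_iff tang_edge sym_prod_bilinear area2_ref)
qed

text \<open>As for \<open>J_pre_eq\<close>, the tangents of the edges \<open>j + 1\<close> and \<open>j + 2\<close> lose their normalisation; only the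
length of edge \<open>j\<close>, which comes from the normal \<open>n\<^sub>j\<close>, remains.\<close>

lemma N_pre_eq:
  assumes "pos_triangle z"
  shows "N_pre z j k = (\<lambda>x. - ((len z j)\<^sup>2 / (area2 z)\<^sup>2 * (if k = 0 then 1 else bary z (j + 1) x - bary z j x))
    *\<^sub>R (edge z (j + 1) \<odot> edge z (j + 2)))"
proof -
  let ?L = "len z j" and ?L1 = "len z (j + 1)" and ?L2 = "len z (j + 2)"
  note L = len_pos[OF assms, of j] len_pos[OF assms, of "j + 1"] len_pos[OF assms, of "j + 2"]
  have t: "tang z (j + 1) \<bullet> nrml z j = - area2 z / (?L1 * ?L)" "tang z (j + 2) \<bullet> nrml z j = area2 z / (?L2 * ?L)"
    using nrml_edge[of z j] by (simp_all add: tang_edge[of z "j + 1"] tang_edge[of z "j + 2"] inner_commute[of _ "nrml z j"])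
  show ?thesis
    using L area2_pos[OF assms] unfolding N_pre_def sym_prod_def[symmetric] Let_def t
    by (simp add: fun_eq_iff tang_edge sym_prod_bilinear power2_eq_square)
qed

section \<open>Traces of the tensors\<close>

lemma sym_prod_has_derivative [derivative_intros]:
  "(u has_derivative u') (at x within S) \<Longrightarrow> (v has_derivative v') (at x within S) \<Longrightarrow>
   ((\<lambda>x. u x \<odot> v x) has_derivative (\<lambda>h. u x \<odot> v' h + u' h \<odot> v x)) (at x within S)"
  by (rule bounded_bilinear.FDERIV[OF bounded_bilinear_sym_prod])

lemma continuous_sym_prod [continuous_intros]:
  "continuous_on S u \<Longrightarrow> continuous_on S v \<Longrightarrow> continuous_on S (\<lambda>x. u x \<odot> v x)"
  by (rule bounded_bilinear.continuous_on[OF bounded_bilinear_sym_prod])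

lemma continuous_bary [continuous_intros]: "continuous_on S (bary z j)"
  by (intro continuous_at_imp_continuous_on ballI has_derivative_continuous[OF bary_has_derivative])

lemma corner_tensor_has_derivative:
  assumes "pos_triangle z"
  shows "(corner_tensor z j has_derivative (\<lambda>h. - (dbary z j h / area2 z) *\<^sub>R (edge z j \<odot> edge z (j + 2)))) (at x)"
  unfolding corner_tensor_def using area2_pos[OF assms] by (auto intro!: derivative_eq_intros)

lemma T_tri_0_has_derivative:
  assumes "pos_triangle z"
  shows "(T_tri z j 0 has_derivative (\<lambda>h. - (1 / area2 z) *\<^sub>R (bary z (j + 2) x *\<^sub>R ((x - z (j + 2)) \<odot> h + h \<odot> (x - z (j + 2)))
     + dbary z (j + 2) h *\<^sub>R ((x - z (j + 2)) \<odot> (x - z (j + 2)))))) (at x)"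
  unfolding T_tri_0[OF assms] using area2_pos[OF assms]
  by (auto intro!: derivative_eq_intros simp: fun_eq_iff algebra_simps scaleR_add_right)

lemma T_tri_1_has_derivative:
  assumes "pos_triangle z"
  shows "(T_tri z j 1 has_derivative (\<lambda>h. (1 / area2 z) *\<^sub>R
    (h \<odot> (bary z (j + 1) x *\<^sub>R (x - z (j + 1)) - bary z j x *\<^sub>R (x - z j)) +
     (x - z (j + 2)) \<odot> (bary z (j + 1) x *\<^sub>R h + dbary z (j + 1) h *\<^sub>R (x - z (j + 1)) - (bary z j x *\<^sub>R h + dbary z j h *\<^sub>R (x - z j)))))) (at x)"
  unfolding T_tri_1[OF assms]
  by (auto intro!: derivative_eq_intros simp: fun_eq_iff add.commute)

lemma N_pre_has_derivative:
  assumes "pos_triangle z"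
  shows "(N_pre z j k has_derivative (\<lambda>h. - ((len z j)\<^sup>2 / (area2 z)\<^sup>2 * (if k = 0 then 0 else dbary z (j + 1) h - dbary z j h))
    *\<^sub>R (edge z (j + 1) \<odot> edge z (j + 2)))) (at x)"
proof -
  have "((\<lambda>x. - (c * (if k = 0 then 1 else bary z (j + 1) x - bary z j x)) *\<^sub>R S) has_derivative
    (\<lambda>h. - (c * (if k = 0 then 0 else dbary z (j + 1) h - dbary z j h)) *\<^sub>R S)) (at x)"
    for c and S :: "real^2^2"
    by (cases "k = 0") (auto intro!: derivative_eq_intros)
  then show ?thesis
    unfolding N_pre_eq[OF assms] .
qed

lemma smooth_corner:
  assumes "pos_triangle z"
  shows "corner_tensor z j \<in> smooth_tensors"
  by (rule smooth_tensorsI[OF corner_tensor_has_derivative[OF assms]]) (auto intro!: continuous_intros)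

lemma smooth_T_tri:
  assumes "pos_triangle z" "k \<in> {0, 1}"
  shows "T_tri z j k \<in> smooth_tensors"
proof -
  have "T_tri z j 0 \<in> smooth_tensors"
    by (rule smooth_tensorsI[OF T_tri_0_has_derivative[OF assms(1)]])
     (intro continuous_intros)
  moreover have "T_tri z j 1 \<in> smooth_tensors"
    by (rule smooth_tensorsI[OF T_tri_1_has_derivative[OF assms(1)]])
     (intro continuous_intros)
  ultimately show ?thesis using assms(2) by auto
qed

lemma smooth_N_pre:
  assumes "pos_triangle z"
  shows "N_pre z j k \<in> smooth_tensors"
  by (rule smooth_tensorsI[OF N_pre_has_derivative[OF assms]]) (intro continuous_intros)

text \<open>In the frame of edge \<open>l\<close>, the normal components of the edge vectors depend on the area and the length
of the edge only. The tangential components of the other two edges, which involve the angles, always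
meet a vanishing factor below.\<close>

lemma edge_frame:
  assumes "pos_triangle z"
  shows "nrml z l \<bullet> edge z l = 0" "edge z l \<bullet> nrml z l = 0"
    "nrml z l \<bullet> edge z (l + 1) = - area2 z / len z l" "edge z (l + 1) \<bullet> nrml z l = - area2 z / len z l"
    "nrml z l \<bullet> edge z (l + 2) = area2 z / len z l" "edge z (l + 2) \<bullet> nrml z l = area2 z / len z l"
    "tang z l \<bullet> edge z l = len z l" "edge z l \<bullet> tang z l = len z l"
proof -
  have "edge z l \<bullet> tang z l = len z l"
    using frame_orthonormal[OF assms, of l] by (simp add: edge_tang[OF assms])
  then show "nrml z l \<bullet> edge z l = 0" "edge z l \<bullet> nrml z l = 0"
    "nrml z l \<bullet> edge z (l + 1) = - area2 z / len z l" "edge z (l + 1) \<bullet> nrml z l = - area2 z / len z l"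
    "nrml z l \<bullet> edge z (l + 2) = area2 z / len z l" "edge z (l + 2) \<bullet> nrml z l = area2 z / len z l"
    "tang z l \<bullet> edge z l = len z l" "edge z l \<bullet> tang z l = len z l"
    using nrml_edge[of z l] by (simp_all add: inner_commute)
qed

text \<open>The corner tensor is an affine function times a constant tensor, so its tangential trace is constant.\<close>

lemma tr_t_corner:
  assumes "pos_triangle z"
  shows "tr_t z l (corner_tensor z l) x = 1 / len z l"
    "tr_t z l (corner_tensor z (l + 1)) x = 1 / len z l"
    "tr_t z l (corner_tensor z (l + 2)) x = - 1 / len z l"
  using len_pos[OF assms, of l] area2_pos[OF assms]
  by (simp_all add: tr_t_eq[OF assms corner_tensor_has_derivative[OF assms]] inner_matrix_linear inner_mult_sym_prod
      index_shift edge_frame[OF assms] dbary_frame[OF assms] frame_orthonormal[OF assms] del: scaleR_minus_left)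

text \<open>Each edge either contains one of the two directions of the tensor, which is orthogonal to the normal,
or it is the edge opposite to \<open>z k\<close>, where the barycentric coordinate vanishes.\<close>

lemma tr_n_corner:
  assumes "pos_triangle z"
  shows "tr_n z l (corner_tensor z k) (edge_at z l s) = 0"
  by (cases rule: cyclic_cases[of k l]) (simp_all add: tr_n_def corner_tensor_def inner_matrix_linear inner_mult_sym_prod
      index_shift edge_frame[OF assms] bary_edge_at[OF assms] del: scaleR_minus_left)

text \<open>The two edges that meet in \<open>z k\<close> contribute \<open>1/2\<close> each to the jump.\<close>

lemma jump_corner:
  assumes "pos_triangle z"
  shows "jump z l (corner_tensor z k) = (if l = k then 1 else 0)"
proof (cases "l = k")
  case True
  then show ?thesis
    using area2_pos[OF assms] len_pos[OF assms, of k] len_pos[OF assms, of "k + 2"]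
      edge_frame[OF assms, of k] edge_frame[OF assms, of "k + 2"]
    by (simp add: jump_def tr_tn_def corner_tensor_def inner_matrix_linear inner_mult_sym_prod
      index_shift bary_vertex[OF assms] del: scaleR_minus_left)
next
  case False
  then show ?thesis
    by (simp add: jump_def tr_tn_def corner_tensor_def inner_matrix_linear bary_vertex[OF assms] del: scaleR_minus_left)
qed

text \<open>On edge \<open>j\<close> either the scalar factor vanishes (first kind) or the second vector factor is tangential
(second kind). On the other two edges \<open>x - z (j + 2)\<close> is tangential.\<close>

lemma tr_n_T_tri:
  assumes "pos_triangle z" "k \<in> {0, 1}"
  shows "tr_n z l (T_tri z j k) (edge_at z l s) = 0"
proof -
  have "tr_n z l (T_tri z j 0) (edge_at z l s) = 0"
    by (cases rule: cyclic_cases[of j l])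
      (simp_all add: tr_n_def T_tri_0[OF assms(1)] inner_matrix_linear inner_mult_sym_prod index_shift
      edge_frame[OF assms(1)] bary_edge_at[OF assms(1)] edge_at_diff[OF assms(1)] frame_orthonormal[OF assms(1)] del: scaleR_minus_left)
  moreover have "tr_n z l (T_tri z j 1) (edge_at z l s) = 0"
    unfolding T_tri_1[OF assms(1)] tr_n_def
    by (cases rule: cyclic_cases[of j l])
      (simp_all add:  inner_matrix_linear inner_mult_sym_prod index_shift inner_diff inner_add
      edge_frame[OF assms(1)] bary_edge_at[OF assms(1)] edge_at_diff[OF assms(1)] frame_orthonormal[OF assms(1)])
  ultimately show ?thesis using assms(2) by auto
qed

lemma T_tri_vertex:
  assumes "pos_triangle z" "k \<in> {0, 1}"
  shows "T_tri z j k (z l) = 0"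
proof -
  have "T_tri z j 0 (z l) = 0"
    by (cases rule: cyclic_cases[of j l])
      (simp_all add: T_tri_0[OF assms(1)] index_shift bary_vertex[OF assms(1)] sym_prod_self outer_def vec_eq_iff)
  moreover have "T_tri z j 1 (z l) = 0"
    unfolding T_tri_1[OF assms(1)]
    by (cases rule: cyclic_cases[of j l])
      (simp_all add: index_shift bary_vertex[OF assms(1)] vec_eq_iff sym_prod_nth)
  ultimately show ?thesis using assms(2) by auto
qed

lemma tr_t_T_tri_0:
  assumes "pos_triangle z"
  shows "tr_t z l (T_tri z j 0) (edge_at z l s) = (if l = j then 1 / len z l else 0)"
  using len_pos[OF assms, of l] area2_pos[OF assms]
  by (cases rule: cyclic_cases[of j l])
    (simp_all add: tr_t_eq[OF assms T_tri_0_has_derivative[OF assms]] inner_matrix_linear inner_mult_sym_prod index_shift inner_diff inner_add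
      edge_frame[OF assms] bary_edge_at[OF assms] edge_at_diff[OF assms] frame_orthonormal[OF assms] dbary_frame[OF assms]
      del: scaleR_minus_left)

text \<open>The value is the Legendre polynomial \<open>2 \<tau> - 1\<close> of edge \<open>j\<close> times three over its length, which is the
multiple whose moment against the Legendre polynomial is \<open>1\<close>.\<close>

lemma tr_t_T_tri_1:
  assumes "pos_triangle z"
  shows "tr_t z l (T_tri z j 1) (edge_at z l s) = (if l = j then - 3 / len z l + 6 / len z l * (s / len z l) else 0)"
  using len_pos[OF assms, of l] area2_pos[OF assms]
  unfolding tr_t_eq[OF assms T_tri_1_has_derivative[OF assms]]
  by (cases rule: cyclic_cases[of j l];
     simp only: inner_matrix_linear inner_mult_sym_prod index_shift edge_at_diff[OF assms] bary_edge_at[OF assms] dbary_frame[OF assms]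
       inner_diff_left inner_diff_right inner_add_left inner_add_right inner_scaleR_left inner_scaleR_right
       edge_frame[OF assms] frame_orthonormal[OF assms];
     simp add: field_simps)

section \<open>Duality\<close>

lemma dof_index_cases:
  assumes "i \<in> dof_indices"
  obtains l k where "i = Nrm l k" "k \<in> {0, 1}" | l k where "i = Tan l k" "k \<in> {0, 1}" | l where "i = Jmp l"
  using assms by (auto simp: dof_indices_def)

lemma dof_T_tri:
  assumes z: "pos_triangle z" and i: "i \<in> dof_indices" and k: "k \<in> {0, 1}"
  shows "dof z i (T_tri z j k) = (if i = Tan j k then 1 else 0)"
  using i
proof (cases rule: dof_index_cases)
  case (1 l m)
  then show ?thesis
    using dof_Nrm_affine[OF z, of l "T_tri z j k" 0 0] tr_n_T_tri[OF z k] by (auto simp del: dof.simps)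
next
  case (2 l m)
  have "dof z (Tan l m) (T_tri z j 0) = (if l = j \<and> m = 0 then 1 else 0)"
    using dof_Tan_affine[OF z, of l "T_tri z j 0" "if l = j then 1 / len z l else 0" 0] tr_t_T_tri_0[OF z]
      len_pos[OF z, of l] 2 by (auto simp del: dof.simps)
  moreover have "dof z (Tan l m) (T_tri z j 1) = (if l = j \<and> m = 1 then 1 else 0)"
    using dof_Tan_affine[OF z, of l "T_tri z j 1" "if l = j then - 3 / len z l else 0" "if l = j then 6 / len z l else 0"]
      tr_t_T_tri_1[OF z] len_pos[OF z, of l] 2 by (auto simp del: dof.simps One_nat_def)
  ultimately show ?thesis using k 2 by (auto simp del: dof.simps)
next
  case (3 l)
  then show ?thesis by (simp add: jump_def tr_tn_def T_tri_vertex[OF z k])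
qed

text \<open>Besides the jump only the three mean values of the tangential trace survive. They do not depend on
the triangle, so the correction computed on the reference triangle is right on every triangle.\<close>

lemma dof_corner:
  assumes z: "pos_triangle z"
  shows "m \<in> {0, 1} \<Longrightarrow> dof z (Nrm l m) (corner_tensor z j) = 0"
    "dof z (Tan l 0) (corner_tensor z j) = (if l = j + 1 then - 1 else 1)"
    "dof z (Tan l 1) (corner_tensor z j) = 0"
    "dof z (Jmp l) (corner_tensor z j) = (if l = j then 1 else 0)"
proof -
  show "dof z (Nrm l m) (corner_tensor z j) = 0" if "m \<in> {0, 1}"
    using dof_Nrm_affine[OF z, of l "corner_tensor z j" 0 0] tr_n_corner[OF z] that by (auto simp del: dof.simps)
  have "tr_t z l (corner_tensor z j) x = (if l = j + 1 then - 1 else 1) / len z l" for x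
    using tr_t_corner[OF z] by (cases rule: cyclic_cases[of j l]) (simp_all add: index_shift)
  note t = dof_Tan_affine[OF z, of l "corner_tensor z j" "(if l = j + 1 then - 1 else 1) / len z l" 0, unfolded this]
  show "dof z (Tan l 0) (corner_tensor z j) = (if l = j + 1 then - 1 else 1)" "dof z (Tan l 1) (corner_tensor z j) = 0"
    using t len_pos[OF z, of l] by (simp_all del: dof.simps One_nat_def)
  show "dof z (Jmp l) (corner_tensor z j) = (if l = j then 1 else 0)"
    by (simp add: jump_corner[OF z])
qed

text \<open>The coefficients of the correction are evaluated by \<open>dof_corner\<close> on the reference triangle; all
pieces then commute with the transformation.\<close>

lemma J_tri_eq:
  assumes z: "pos_triangle z"
  shows "J_tri z j = corner_tensor z j - (T_tri z j 0 - T_tri z (j + 1) 0 + T_tri z (j + 2) 0)"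
proof -
  have "edge_inner ref_triangle l (tr_t ref_triangle l (corner_tensor ref_triangle j)) (\<lambda>x. 1)
     = (if l = j + 1 then - 1 else 1)" for l
    using dof_corner(2)[OF pos_triangle_ref, of l j] by (simp add: edge_legendre_0)
  then have J: "J_ref j p = corner_tensor ref_triangle j p - (T_ref j 0 p - T_ref (j + 1) 0 p + T_ref (j + 2) 0 p)" for p
    by (simp add: J_ref_def J_pre_eq sum_cyclic[of _ j] index_shift)
  have "piola z (T_ref l 0) (FK z p) = (1 / area2 z) *\<^sub>R (BK z ** T_ref l 0 p ** transpose (BK z))" for l p
    using bij_is_inj[OF bij_FK[OF z]] by (simp add: piola_def)
  moreover have "corner_tensor z j (FK z p)
      = (1 / area2 z) *\<^sub>R (BK z ** corner_tensor ref_triangle j p ** transpose (BK z))" for p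
    by (simp add: corner_tensor_def bary_FK[OF z] congruence_linear congruence_sym_prod BK_edge area2_ref)
  ultimately show ?thesis
    unfolding J_tri_def by (intro piola_eqI[OF z]) (simp add: J congruence_linear T_tri_def scaleR_diff_right scaleR_add_right)
qed

lemma smooth_J_tri:
  assumes "pos_triangle z"
  shows "J_tri z j \<in> smooth_tensors"
  unfolding J_tri_eq[OF assms]
  using smooth_corner[OF assms] smooth_T_tri[OF assms]
  by (intro subspace_diff subspace_add subspace_smooth_tensors) auto

lemma dof_J_tri:
  assumes z: "pos_triangle z" and i: "i \<in> dof_indices"
  shows "dof z i (J_tri z j) = (if i = Jmp j then 1 else 0)"
proof -
  have s: "T_tri z l 0 \<in> smooth_tensors" for l
    by (rule smooth_T_tri[OF z]) simp
  have s1: "T_tri z j 0 - T_tri z (j + 1) 0 \<in> smooth_tensors" "T_tri z j 0 - T_tri z (j + 1) 0 + T_tri z (j + 2) 0 \<in> smooth_tensors"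
    using s by (auto intro!: subspace_diff subspace_add subspace_smooth_tensors)
  have "dof z i (J_tri z j) = dof z i (corner_tensor z j) -
    (dof z i (T_tri z j 0) - dof z i (T_tri z (j + 1) 0) + dof z i (T_tri z (j + 2) 0))"
    unfolding J_tri_eq[OF z]
    by (simp only: dof_linear(2)[OF z smooth_corner[OF z] s1(2)] dof_linear(1)[OF z s1(1) s] dof_linear(2)[OF z s s])
  also have "\<dots> = (if i = Jmp j then 1 else 0)"
    using i
  proof (cases rule: dof_index_cases)
    case (1 l m)
    then show ?thesis using dof_corner(1)[OF z] dof_T_tri[OF z i, of 0] by (auto simp del: dof.simps)
  next
    case (2 l m)
    have "l = j \<or> l = j + 1 \<or> l = j + 2"
      using cyclic_cases[of l j] by blast
    then show ?thesis
      using dof_corner(2,3)[OF z, of l j] dof_T_tri[OF z i, of 0] 2 by (auto simp del: dof.simps simp: index_shift)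
  next
    case (3 l)
    then show ?thesis using dof_corner(4)[OF z, of l j] dof_T_tri[OF z i, of 0] by (auto simp del: dof.simps)
  qed
  finally show ?thesis .
qed

lemma tr_t_N_pre:
  assumes z: "pos_triangle z"
  shows "tr_t z l (N_pre z j k) x = tr_t z l (N_pre z j k) y" "tr_t z l (N_pre z j 0) x = 0"
  by (simp_all add: tr_t_eq[OF z N_pre_has_derivative[OF z]])

lemma tr_n_N_pre:
  assumes z: "pos_triangle z" and k: "k \<in> {0, 1}"
  shows "tr_n z l (N_pre z j k) (edge_at z l s) = (if l = j then if k = 0 then 1 else 2 * (s / len z l) - 1 else 0)"
  using len_pos[OF z, of l] area2_pos[OF z] k
  unfolding tr_n_def N_pre_eq[OF z]
  by (cases rule: cyclic_cases[of j l];
     simp only: inner_matrix_linear inner_mult_sym_prod index_shift bary_edge_at[OF z] edge_frame[OF z];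
     auto simp: field_simps power2_eq_square)

lemma dof_N_pre:
  assumes z: "pos_triangle z" and k: "k \<in> {0, 1}"
  shows "m \<in> {0, 1} \<Longrightarrow> dof z (Nrm l m) (N_pre z j k) = (if l = j \<and> m = k then 1 else 0)"
    "dof z (Tan l 1) (N_pre z j k) = 0" "dof z (Tan l 0) (N_pre z j 0) = 0"
proof -
  show "dof z (Nrm l m) (N_pre z j k) = (if l = j \<and> m = k then 1 else 0)" if "m \<in> {0, 1}"
  proof -
    have "tr_n z l (N_pre z j k) (edge_at z l s) = (if l = j then if k = 0 then 1 else - 1 else 0)
      + (if l = j \<and> k = 1 then 2 else 0) * (s / len z l)" for s
      using tr_n_N_pre[OF z k, of l j s] k by auto
    from dof_Nrm_affine[OF z this] show ?thesis
      using that k by (auto simp del: dof.simps)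
  qed
  show "dof z (Tan l 1) (N_pre z j k) = 0"
    using dof_Tan_affine(2)[OF z, of l "N_pre z j k" "tr_t z l (N_pre z j k) 0" 0] tr_t_N_pre(1)[OF z, of l j k _ 0]
    by (simp del: dof.simps One_nat_def)
  show "dof z (Tan l 0) (N_pre z j 0) = 0"
    using dof_Tan_affine(1)[OF z, of l "N_pre z j 0" 0 0] tr_t_N_pre(2)[OF z, of l j]
    by (simp del: dof.simps One_nat_def)
qed

text \<open>For \<open>k = 0\<close> the uncorrected tensor is constant, so its tangential traces vanish and the first sum may
be included. Both cases of the definition thus have the same shape.\<close>

lemma N_tri_eq:
  assumes z: "pos_triangle z" and k: "k \<in> {0, 1}"
  shows "N_tri z j k = N_pre z j k - (\<Sum>l\<in>UNIV. dof z (Tan l 0) (N_pre z j k) *\<^sub>R T_tri z l 0)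
    - (\<Sum>l\<in>UNIV. dof z (Jmp l) (N_pre z j k) *\<^sub>R J_tri z l)"
proof (cases "k = 0")
  case True
  have "(\<Sum>l\<in>UNIV. dof z (Tan l 0) (N_pre z j 0) *\<^sub>R T_tri z l 0) = 0"
    by (simp only: dof_N_pre(3)[OF z k] scaleR_zero_left sum.neutral_const)
  then have "N_pre z j 0 - (\<Sum>l\<in>UNIV. dof z (Tan l 0) (N_pre z j 0) *\<^sub>R T_tri z l 0) = N_pre z j 0"
    by (simp only: diff_0_right)
  then show ?thesis unfolding True by (simp only: N_tri_def refl if_True dof.simps)
next
  case False
  then have "k = 1" using k by auto
  then show ?thesis
    unfolding N_tri_def by (simp only: dof.simps edge_legendre_0 if_False one_neq_zero)
qed

lemma smooth_N_tri:
  assumes z: "pos_triangle z" and k: "k \<in> {0, 1}"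
  shows "N_tri z j k \<in> smooth_tensors"
  unfolding N_tri_eq[OF assms]
  using smooth_N_pre[OF z] smooth_T_tri[OF z] smooth_J_tri[OF z]
  by (intro subspace_diff subspace_sum subspace_scale subspace_smooth_tensors) auto

text \<open>The uncorrected tensor has the right normal moments, and its tangential traces are constant. The
corrections are dual to exactly the functionals they are meant to cancel.\<close>

lemma dof_N_tri:
  assumes z: "pos_triangle z" and i: "i \<in> dof_indices" and k: "k \<in> {0, 1}"
  shows "dof z i (N_tri z j k) = (if i = Nrm j k then 1 else 0)"
proof -
  let ?N = "N_pre z j k"
  have s: "T_tri z l 0 \<in> smooth_tensors" for l
    by (rule smooth_T_tri[OF z]) simp
  have s1: "(\<Sum>l\<in>UNIV. dof z (Tan l 0) ?N *\<^sub>R T_tri z l 0) \<in> smooth_tensors"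
    "(\<Sum>l\<in>UNIV. dof z (Jmp l) ?N *\<^sub>R J_tri z l) \<in> smooth_tensors"
    using s smooth_J_tri[OF z] by (auto intro!: subspace_sum subspace_scale subspace_smooth_tensors)
  have s2: "?N - (\<Sum>l\<in>UNIV. dof z (Tan l 0) ?N *\<^sub>R T_tri z l 0) \<in> smooth_tensors"
    by (rule subspace_diff[OF subspace_smooth_tensors smooth_N_pre[OF z] s1(1)])
  have "dof z i (N_tri z j k) = dof z i ?N - (\<Sum>l\<in>UNIV. dof z (Tan l 0) ?N * dof z i (T_tri z l 0))
    - (\<Sum>l\<in>UNIV. dof z (Jmp l) ?N * dof z i (J_tri z l))"
    unfolding N_tri_eq[OF z k]
    by (simp only: dof_linear(2)[OF z s2 s1(2)] dof_linear(2)[OF z smooth_N_pre[OF z] s1(1)] dof_sum[OF z s] dof_sum[OF z smooth_J_tri[OF z]])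
  also have "\<dots> = dof z i ?N - (\<Sum>l\<in>UNIV. if i = Tan l 0 then dof z (Tan l 0) ?N else 0)
    - (\<Sum>l\<in>UNIV. if i = Jmp l then dof z (Jmp l) ?N else 0)"
    by (simp add: dof_T_tri[OF z i] dof_J_tri[OF z i] if_distrib cong: if_cong del: dof.simps)
  also have "\<dots> = (if i = Nrm j k then 1 else 0)"
    using i
    by (cases rule: dof_index_cases) (use dof_N_pre[OF z k] in \<open>auto simp del: dof.simps One_nat_def\<close>)
  finally show ?thesis .
qed

lemma smooth_basis_tensor:
  assumes "pos_triangle z" "i \<in> dof_indices"
  shows "basis_tensor z i \<in> smooth_tensors"
  using assms(2)
  by (cases rule: dof_index_cases) (simp_all add: smooth_N_tri smooth_T_tri smooth_J_tri assms(1))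

lemma dof_basis_tensor:
  assumes "pos_triangle z" "i \<in> dof_indices" "i' \<in> dof_indices"
  shows "dof z i (basis_tensor z i') = (if i = i' then 1 else 0)"
  using assms(3)
  by (cases rule: dof_index_cases) (simp_all add: dof_N_tri dof_T_tri dof_J_tri assms(1,2) del: dof.simps)

lemma finite_dof_indices: "finite dof_indices"
  and card_dof_indices: "card dof_indices = 15"
proof -
  let ?is = "[Nrm 1 0, Nrm 1 1, Nrm 2 0, Nrm 2 1, Nrm 3 0, Nrm 3 1,
    Tan 1 0, Tan 1 1, Tan 2 0, Tan 2 1, Tan 3 0, Tan 3 1, Jmp 1, Jmp 2, Jmp 3]"
  have eq: "dof_indices = set ?is"
    using exhaust_3 by (fastforce simp: dof_indices_def image_iff)
  have "distinct ?is" by simp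
  from distinct_card[OF this] show "card dof_indices = 15"
    unfolding eq by (simp only:) simp
  show "finite dof_indices"
    unfolding eq by (rule finite_set)
qed

lemma inj_on_basis_tensor:
  assumes "pos_triangle z"
  shows "inj_on (basis_tensor z) dof_indices"
proof (rule inj_onI)
  fix i i' assume "i \<in> dof_indices" "i' \<in> dof_indices" "basis_tensor z i = basis_tensor z i'"
  then show "i = i'"
    using dof_basis_tensor[OF assms, of i i] dof_basis_tensor[OF assms, of i i']
    by (auto split: if_splits simp del: dof.simps)
qed

text \<open>Applying the dual functional of one tensor to a vanishing linear combination isolates its
coefficient.\<close>

lemma independent_BB:
  assumes z: "pos_triangle z"
  shows "independent (BB z)"
proof (rule independent_if_scalars_zero)
  show "finite (BB z)" by (simp add: BB_def finite_dof_indices)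
  fix c B assume 0: "(\<Sum>M\<in>BB z. c M *\<^sub>R M) = 0" and "B \<in> BB z"
  then obtain i where i: "i \<in> dof_indices" "B = basis_tensor z i" by (auto simp: BB_def)
  have "(\<Sum>i\<in>dof_indices. c (basis_tensor z i) *\<^sub>R basis_tensor z i) = 0"
    using 0 unfolding BB_def sum.reindex[OF inj_on_basis_tensor[OF z]] by (simp add: o_def)
  then have "0 = (\<Sum>i'\<in>dof_indices. c (basis_tensor z i') * dof z i (basis_tensor z i'))"
    using dof_sum[OF z smooth_basis_tensor[OF z], of dof_indices "\<lambda>i. i" i "\<lambda>i. c (basis_tensor z i)"] dof_zero[OF z, of i]
    by (simp del: dof.simps)
  also have "\<dots> = (\<Sum>i'\<in>dof_indices. if i = i' then c (basis_tensor z i') else 0)"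
    by (rule sum.cong) (simp_all add: dof_basis_tensor[OF z i(1)] del: dof.simps)
  also have "\<dots> = c B"
    using i finite_dof_indices by simp
  finally show "c B = 0" by simp
qed

section \<open>The tensor space has dimension at most fifteen\<close>

lemma sym_part_linear: "sym_part (M + N) = sym_part M + sym_part N" "sym_part (c *\<^sub>R M) = c *\<^sub>R sym_part M"
  by (simp_all add: sym_part_def transpose_def vec_eq_iff field_simps)

text \<open>Taking the symmetric part is linear, so it can be pulled into the span.\<close>

lemma XX_eq: "XX = span {(\<lambda>x. \<phi> x \<odot> \<psi> x) | \<phi> \<psi>. \<phi> \<in> RT 0 \<and> \<psi> \<in> RT 1}"
proof -
  let ?f = "\<lambda>(M :: tensor_field) x. sym_part (M x)"
  have image: "f ` {g a b | a b. P a b} = {f (g a b) | a b. P a b}"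
    for f :: "tensor_field \<Rightarrow> tensor_field" and g and P :: "vector_field \<Rightarrow> vector_field \<Rightarrow> bool"
    by auto
  have lin: "linear ?f"
    by (rule linearI) (simp_all add: fun_eq_iff sym_part_linear)
  have "XX = span (?f ` {(\<lambda>x. outer (\<phi> x) (\<psi> x)) | \<phi> \<psi>. \<phi> \<in> RT 0 \<and> \<psi> \<in> RT 1})"
    unfolding XX_def tensor_space_def by (rule linear_span_image[OF lin, symmetric])
  also have "?f ` {(\<lambda>x. outer (\<phi> x) (\<psi> x)) | \<phi> \<psi>. \<phi> \<in> RT 0 \<and> \<psi> \<in> RT 1}
    = {(\<lambda>x. sym_part (outer (\<phi> x) (\<psi> x))) | \<phi> \<psi>. \<phi> \<in> RT 0 \<and> \<psi> \<in> RT 1}"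
    by (rule image)
  finally show ?thesis unfolding sym_prod_def .
qed

lemma Poly_0: "f \<in> Poly 0 \<longleftrightarrow> (\<exists>c. f = (\<lambda>x. c))"
proof -
  have "{monomial a b | a b. a + b \<le> 0} = {monomial 0 0}" by auto
  then show ?thesis
    by (auto simp: Poly_def span_singleton monomial_def fun_eq_iff)
qed

lemma Poly_1: "f \<in> Poly 1 \<longleftrightarrow> (\<exists>c a b. f = (\<lambda>x. c + x $ 1 * a + x $ 2 * b))"
proof -
  have iff: "a + b \<le> 1 \<longleftrightarrow> a = 0 \<and> b = 0 \<or> a = 1 \<and> b = 0 \<or> a = 0 \<and> b = 1" for a b :: nat
    by auto
  have "{monomial a b | a b. a + b \<le> 1} = {monomial 0 0, monomial 1 0, monomial 0 1}"
    unfolding iff by auto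
  moreover have "f - k *\<^sub>R monomial 0 0 - k' *\<^sub>R monomial 1 0 - k'' *\<^sub>R monomial 0 1 = 0
      \<longleftrightarrow> f = (\<lambda>x. k + x $ 1 * k' + x $ 2 * k'')" for k k' k''
    unfolding fun_eq_iff by (intro iff_allI) (auto simp: monomial_def algebra_simps)
  ultimately show ?thesis
    by (simp only: Poly_def span_breakdown_eq span_empty singleton_iff)
qed

lemma Poly_hom_0: "f \<in> Poly_hom 0 \<longleftrightarrow> (\<exists>c. f = (\<lambda>x. c))"
proof -
  have "{monomial a b | a b. a + b = 0} = {monomial 0 0}" by auto
  then show ?thesis
    by (auto simp: Poly_hom_def span_singleton monomial_def fun_eq_iff)
qed

lemma Poly_hom_1: "f \<in> Poly_hom 1 \<longleftrightarrow> (\<exists>a b. f = (\<lambda>x. x $ 1 * a + x $ 2 * b))"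
proof -
  have iff: "a + b = 1 \<longleftrightarrow> a = 1 \<and> b = 0 \<or> a = 0 \<and> b = 1" for a b :: nat
    by auto
  have "{monomial a b | a b. a + b = 1} = {monomial 1 0, monomial 0 1}"
    unfolding iff by auto
  moreover have "f - k' *\<^sub>R monomial 1 0 - k'' *\<^sub>R monomial 0 1 = 0
      \<longleftrightarrow> f = (\<lambda>x. x $ 1 * k' + x $ 2 * k'')" for k' k''
    unfolding fun_eq_iff by (intro iff_allI) (auto simp: monomial_def algebra_simps)
  ultimately show ?thesis
    by (simp only: Poly_hom_def span_breakdown_eq span_empty singleton_iff)
qed

lemma RT_I:
  assumes "\<And>i. (\<lambda>x. v x $ i) \<in> Poly p" "q \<in> Poly_hom p" "\<And>x. \<phi> x = v x + q x *\<^sub>R x"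
  shows "\<phi> \<in> RT p"
proof -
  have "\<phi> = (\<lambda>x. v x + q x *\<^sub>R x)" using assms(3) by (rule ext)
  then show ?thesis
    unfolding RT_def mem_Collect_eq using assms(1,2) by (intro exI conjI allI)
qed

lemma RT_E:
  assumes "\<phi> \<in> RT p"
  obtains v q where "\<phi> = (\<lambda>x. v x + q x *\<^sub>R x) \<and> (\<forall>i. (\<lambda>x. v x $ i) \<in> Poly p) \<and> q \<in> Poly_hom p"
  using assms unfolding RT_def mem_Collect_eq by (elim exE)

lemma RT_0: "\<phi> \<in> RT 0 \<longleftrightarrow> (\<exists>a b. \<phi> = (\<lambda>x. a + b *\<^sub>R x))"
proof
  assume "\<phi> \<in> RT 0"
  then obtain v q where "\<phi> = (\<lambda>x. v x + q x *\<^sub>R x) \<and> (\<forall>i. (\<lambda>x. v x $ i) \<in> Poly 0) \<and> q \<in> Poly_hom 0"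
    by (rule RT_E)
  then have v: "\<And>i. (\<lambda>x. v x $ i) \<in> Poly 0" "q \<in> Poly_hom 0" "\<phi> = (\<lambda>x. v x + q x *\<^sub>R x)"
    by simp_all
  have "\<exists>c. \<forall>x. v x $ i = c" for i
    using v(1)[of i] unfolding Poly_0 by (elim exE) (metis (full_types))
  then obtain c where c: "\<And>i x. v x $ i = c i" by metis
  obtain b where "q = (\<lambda>x. b)" using v(2) unfolding Poly_hom_0 by (elim exE)
  with c have "\<phi> = (\<lambda>x. (\<chi> i. c i) + b *\<^sub>R x)"
    by (simp add: v(3) vec_eq_iff fun_eq_iff)
  then show "\<exists>a b. \<phi> = (\<lambda>x. a + b *\<^sub>R x)"
    by (intro exI)
next
  assume "\<exists>a b. \<phi> = (\<lambda>x. a + b *\<^sub>R x)"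
  then obtain a b where "\<phi> = (\<lambda>x. a + b *\<^sub>R x)" by (elim exE)
  then show "\<phi> \<in> RT 0"
    by (intro RT_I[of "\<lambda>x. a" _ "\<lambda>x. b"]) (auto simp: Poly_0 Poly_hom_0)
qed

lemma RT_1: "\<psi> \<in> RT 1 \<longleftrightarrow>
  (\<exists>a b c \<alpha> \<beta>. \<psi> = (\<lambda>x. a + x $ 1 *\<^sub>R b + x $ 2 *\<^sub>R c + (x $ 1 * \<alpha> + x $ 2 * \<beta>) *\<^sub>R x))"
proof
  assume "\<psi> \<in> RT 1"
  then obtain v q where "\<psi> = (\<lambda>x. v x + q x *\<^sub>R x) \<and> (\<forall>i. (\<lambda>x. v x $ i) \<in> Poly 1) \<and> q \<in> Poly_hom 1"
    by (rule RT_E)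
  then have v: "\<And>i. (\<lambda>x. v x $ i) \<in> Poly 1" "q \<in> Poly_hom 1" "\<psi> = (\<lambda>x. v x + q x *\<^sub>R x)"
    by simp_all
  have "\<exists>c a b. \<forall>x. v x $ i = c + x $ 1 * a + x $ 2 * b" for i
    using v(1)[of i] unfolding Poly_1 fun_eq_iff .
  then obtain c a b where c: "\<And>i x. v x $ i = c i + x $ 1 * a i + x $ 2 * b i" by metis
  obtain \<alpha> \<beta> where "q = (\<lambda>x. x $ 1 * \<alpha> + x $ 2 * \<beta>)" using v(2) unfolding Poly_hom_1 by (elim exE)
  with c have "\<psi> = (\<lambda>x. (\<chi> i. c i) + x $ 1 *\<^sub>R (\<chi> i. a i) + x $ 2 *\<^sub>R (\<chi> i. b i) + (x $ 1 * \<alpha> + x $ 2 * \<beta>) *\<^sub>R x)"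
    by (simp add: v(3) vec_eq_iff fun_eq_iff)
  then show "\<exists>a b c \<alpha> \<beta>. \<psi> = (\<lambda>x. a + x $ 1 *\<^sub>R b + x $ 2 *\<^sub>R c + (x $ 1 * \<alpha> + x $ 2 * \<beta>) *\<^sub>R x)"
    by (intro exI)
next
  assume "\<exists>a b c \<alpha> \<beta>. \<psi> = (\<lambda>x. a + x $ 1 *\<^sub>R b + x $ 2 *\<^sub>R c + (x $ 1 * \<alpha> + x $ 2 * \<beta>) *\<^sub>R x)"
  then obtain a b c \<alpha> \<beta> where \<psi>: "\<psi> = (\<lambda>x. a + x $ 1 *\<^sub>R b + x $ 2 *\<^sub>R c + (x $ 1 * \<alpha> + x $ 2 * \<beta>) *\<^sub>R x)"
    by (elim exE)
  show "\<psi> \<in> RT 1"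
  proof (rule RT_I)
    show "(\<lambda>x. (a + x $ 1 *\<^sub>R b + x $ 2 *\<^sub>R c) $ i) \<in> Poly 1" for i
      unfolding Poly_1 by (rule exI[of _ "a $ i"], rule exI[of _ "b $ i"], rule exI[of _ "c $ i"]) simp
    show "(\<lambda>x. x $ 1 * \<alpha> + x $ 2 * \<beta>) \<in> Poly_hom 1"
      unfolding Poly_hom_1 by (intro exI) (rule refl)
  qed (simp add: \<psi>)
qed

lemma sym_prod_in_XX: "\<phi> \<in> RT 0 \<Longrightarrow> \<psi> \<in> RT 1 \<Longrightarrow> (\<lambda>x. \<phi> x \<odot> \<psi> x) \<in> XX"
  unfolding XX_eq by (rule span_base, unfold mem_Collect_eq, rule exI[of _ \<phi>], rule exI[of _ \<psi>]) simp

lemma subspace_XX: "subspace XX"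
  unfolding XX_eq by (rule subspace_span)

lemma bary_expansion: "bary z j x = bary z j 0 + x $ 1 * dbary z j (axis 1 1) + x $ 2 * dbary z j (axis 2 1)"
proof -
  note l = bounded_linear.linear[OF linear_dbary[of z j]]
  have "x $ 1 *\<^sub>R axis 1 1 + x $ 2 *\<^sub>R axis 2 1 = x"
    by (simp add: vec_eq_iff forall_2 axis_def)
  then have "dbary z j x = dbary z j (x $ 1 *\<^sub>R axis 1 1 + x $ 2 *\<^sub>R axis 2 1)"
    by (rule arg_cong[symmetric])
  then have "dbary z j x = x $ 1 * dbary z j (axis 1 1) + x $ 2 * dbary z j (axis 2 1)"
    by (simp only: linear_add[OF l] linear_scale[OF l] real_scaleR_def)
  then show ?thesis
    using bary_diff[of z j x 0] by simp
qed

lemma affine_times_in_RT_1: "(\<lambda>x. (c * bary z j x) *\<^sub>R (x - w)) \<in> RT 1"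
  unfolding RT_1
proof (intro exI ext)
  fix x :: "real^2"
  let ?g = "bary z j 0" and ?a = "dbary z j (axis 1 1)" and ?b = "dbary z j (axis 2 1)"
  show "(c * bary z j x) *\<^sub>R (x - w) = (- c * ?g) *\<^sub>R w + x $ 1 *\<^sub>R ((c * ?g) *\<^sub>R axis 1 1 - (c * ?a) *\<^sub>R w)
     + x $ 2 *\<^sub>R ((c * ?g) *\<^sub>R axis 2 1 - (c * ?b) *\<^sub>R w) + (x $ 1 * (c * ?a) + x $ 2 * (c * ?b)) *\<^sub>R x"
    unfolding bary_expansion[of z j x]
    by (simp add: vec_eq_iff forall_2 axis_def algebra_simps)
qed

lemma affine_in_RT_1: "(\<lambda>x. (c * bary z j x) *\<^sub>R w) \<in> RT 1" "(\<lambda>x. w) \<in> RT 1"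
proof -
  show "(\<lambda>x. (c * bary z j x) *\<^sub>R w) \<in> RT 1"
    unfolding RT_1
  proof (intro exI ext)
    fix x :: "real^2"
    show "(c * bary z j x) *\<^sub>R w = (c * bary z j 0) *\<^sub>R w + x $ 1 *\<^sub>R ((c * dbary z j (axis 1 1)) *\<^sub>R w)
     + x $ 2 *\<^sub>R ((c * dbary z j (axis 2 1)) *\<^sub>R w) + (x $ 1 * 0 + x $ 2 * 0) *\<^sub>R x"
      unfolding bary_expansion[of z j x] by (simp add: algebra_simps)
  qed
  show "(\<lambda>x. w) \<in> RT 1"
    unfolding RT_1 by (rule exI[of _ w], rule exI[of _ 0], rule exI[of _ 0], rule exI[of _ 0], rule exI[of _ 0]) simp
qed

lemma const_in_RT_0: "(\<lambda>x. a) \<in> RT 0" "(\<lambda>x. x - w) \<in> RT 0"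
proof -
  show "(\<lambda>x. a) \<in> RT 0" unfolding RT_0 by (rule exI[of _ a], rule exI[of _ 0]) simp
  show "(\<lambda>x. x - w) \<in> RT 0" unfolding RT_0 by (rule exI[of _ "- w"], rule exI[of _ 1]) simp
qed

lemma corner_in_XX: "corner_tensor z j \<in> XX"
proof -
  have "corner_tensor z j = (\<lambda>x. edge z j \<odot> ((- 1 / area2 z * bary z j x) *\<^sub>R edge z (j + 2)))"
    by (simp add: corner_tensor_def sym_prod_bilinear fun_eq_iff)
  then show ?thesis
    by (simp only: sym_prod_in_XX[OF const_in_RT_0(1) affine_in_RT_1(1)])
qed

lemma T_tri_in_XX:
  assumes z: "pos_triangle z" and k: "k \<in> {0, 1}"
  shows "T_tri z j k \<in> XX"
proof -
  have "T_tri z j 0 = (\<lambda>x. (x - z (j + 2)) \<odot> ((- 1 / area2 z * bary z (j + 2) x) *\<^sub>R (x - z (j + 2))))"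
    unfolding T_tri_0[OF z] by (simp add: sym_prod_bilinear fun_eq_iff)
  then have "T_tri z j 0 \<in> XX"
    by (simp only: sym_prod_in_XX[OF const_in_RT_0(2) affine_times_in_RT_1])
  moreover have "T_tri z j 1 = (\<lambda>x. (x - z (j + 2)) \<odot> ((1 / area2 z * bary z (j + 1) x) *\<^sub>R (x - z (j + 1))))
      - (\<lambda>x. (x - z (j + 2)) \<odot> ((1 / area2 z * bary z j x) *\<^sub>R (x - z j)))"
    unfolding T_tri_1[OF z] by (simp only: sym_prod_bilinear fun_eq_iff fun_diff_def scaleR_diff_right scaleR_scaleR simp_thms)
  then have "T_tri z j 1 \<in> XX"
    by (simp only: subspace_diff[OF subspace_XX] sym_prod_in_XX[OF const_in_RT_0(2) affine_times_in_RT_1])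
  ultimately show ?thesis using k by auto
qed

lemma J_tri_in_XX:
  assumes z: "pos_triangle z"
  shows "J_tri z j \<in> XX"
  unfolding J_tri_eq[OF z]
  by (intro subspace_diff[OF subspace_XX] subspace_add[OF subspace_XX] corner_in_XX T_tri_in_XX[OF z]) simp_all

lemma N_pre_in_XX:
  assumes z: "pos_triangle z"
  shows "N_pre z j k \<in> XX"
proof (cases "k = 0")
  case True
  have "N_pre z j k = (\<lambda>x. edge z (j + 1) \<odot> (- ((len z j)\<^sup>2 / (area2 z)\<^sup>2) *\<^sub>R edge z (j + 2)))"
    unfolding N_pre_eq[OF z] True by (simp add: sym_prod_bilinear)
  then show ?thesis
    by (simp only: sym_prod_in_XX[OF const_in_RT_0(1) affine_in_RT_1(2)])
next
  case False
  let ?c = "- ((len z j)\<^sup>2 / (area2 z)\<^sup>2)"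
  have "N_pre z j k = (\<lambda>x. edge z (j + 1) \<odot> ((?c * bary z (j + 1) x) *\<^sub>R edge z (j + 2)))
        - (\<lambda>x. edge z (j + 1) \<odot> ((?c * bary z j x) *\<^sub>R edge z (j + 2)))"
  proof
    show "N_pre z j k x = ((\<lambda>x. edge z (j + 1) \<odot> ((?c * bary z (j + 1) x) *\<^sub>R edge z (j + 2)))
        - (\<lambda>x. edge z (j + 1) \<odot> ((?c * bary z j x) *\<^sub>R edge z (j + 2)))) x" for x
      using False unfolding N_pre_eq[OF z]
      by (simp only: sym_prod_bilinear fun_diff_def if_False scaleR_left_diff_distrib[symmetric]
          mult_minus_left right_diff_distrib minus_diff_eq minus_diff_minus)
  qed
  then show ?thesis
    by (simp only: subspace_diff[OF subspace_XX] sym_prod_in_XX[OF const_in_RT_0(1) affine_in_RT_1(1)])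
qed

lemma N_tri_in_XX:
  assumes z: "pos_triangle z" and k: "k \<in> {0, 1}"
  shows "N_tri z j k \<in> XX"
  unfolding N_tri_eq[OF z k]
  by (intro subspace_diff[OF subspace_XX] subspace_sum[OF subspace_XX] subspace_scale[OF subspace_XX]
      N_pre_in_XX[OF z] T_tri_in_XX[OF z] J_tri_in_XX[OF z]) simp_all

lemma BB_subset_XX:
  assumes z: "pos_triangle z"
  shows "BB z \<subseteq> XX"
proof
  fix B assume "B \<in> BB z"
  then obtain i where i: "i \<in> dof_indices" "B = basis_tensor z i" by (auto simp: BB_def)
  from i(1) show "B \<in> XX"
    by (cases rule: dof_index_cases)
      (simp_all only: i(2) basis_tensor.simps N_tri_in_XX[OF z] T_tri_in_XX[OF z] J_tri_in_XX[OF z])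
qed

text \<open>An affine function times a constant symmetric tensor accounts for \<open>3 \<times> 3\<close> fields. The quadratic and
cubic terms of \<open>\<phi> \<odot> \<psi>\<close> always contain a factor \<open>x\<close>, which leaves \<open>4\<close> fields \<open>x\<^sub>i (x \<odot> u)\<close> and \<open>2\<close>
fields \<open>x\<^sub>i (x \<odot> x)\<close>.\<close>

definition XX_generators :: "tensor_field list"
  where "XX_generators = (let e = axis 1 1; f = axis 2 1 in
    [\<lambda>x. e \<odot> e, \<lambda>x. e \<odot> f, \<lambda>x. f \<odot> f,
     \<lambda>x. x $ 1 *\<^sub>R (e \<odot> e), \<lambda>x. x $ 1 *\<^sub>R (e \<odot> f), \<lambda>x. x $ 1 *\<^sub>R (f \<odot> f),
     \<lambda>x. x $ 2 *\<^sub>R (e \<odot> e), \<lambda>x. x $ 2 *\<^sub>R (e \<odot> f), \<lambda>x. x $ 2 *\<^sub>R (f \<odot> f),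
     \<lambda>x. x $ 1 *\<^sub>R (x \<odot> e), \<lambda>x. x $ 1 *\<^sub>R (x \<odot> f), \<lambda>x. x $ 2 *\<^sub>R (x \<odot> e), \<lambda>x. x $ 2 *\<^sub>R (x \<odot> f),
     \<lambda>x. x $ 1 *\<^sub>R (x \<odot> x), \<lambda>x. x $ 2 *\<^sub>R (x \<odot> x)])"

lemma XX_subset_span_generators: "XX \<subseteq> span (set XX_generators)"
  unfolding XX_eq
proof (rule span_minimal[OF _ subspace_span], rule subsetI, unfold mem_Collect_eq, elim exE conjE)
  fix M \<phi> \<psi> assume M: "M = (\<lambda>x. \<phi> x \<odot> \<psi> x)" and "\<phi> \<in> RT 0" "\<psi> \<in> RT 1"
  from this(2) obtain a b where \<phi>: "\<phi> = (\<lambda>x. a + b *\<^sub>R x)"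
    unfolding RT_0 by (elim exE)
  from \<open>\<psi> \<in> RT 1\<close> obtain c A B \<alpha> \<beta> where
    \<psi>: "\<psi> = (\<lambda>x. c + x $ 1 *\<^sub>R A + x $ 2 *\<^sub>R B + (x $ 1 * \<alpha> + x $ 2 * \<beta>) *\<^sub>R x)"
    unfolding RT_1 by (elim exE)
  let ?S = "span (set XX_generators)"
  let ?e = "axis 1 1 :: real^2" and ?f = "axis 2 1 :: real^2"
  have expand: "(\<lambda>x. g x *\<^sub>R (u \<odot> v)) \<in> ?S"
    if "(\<lambda>x. g x *\<^sub>R (?e \<odot> ?e)) \<in> ?S" "(\<lambda>x. g x *\<^sub>R (?e \<odot> ?f)) \<in> ?S" "(\<lambda>x. g x *\<^sub>R (?f \<odot> ?f)) \<in> ?S"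
    for g :: scalar_field and u v
  proof -
    have "(\<lambda>x. g x *\<^sub>R (u \<odot> v)) = (u $ 1 * v $ 1) *\<^sub>R (\<lambda>x. g x *\<^sub>R (?e \<odot> ?e))
        + (u $ 1 * v $ 2 + u $ 2 * v $ 1) *\<^sub>R (\<lambda>x. g x *\<^sub>R (?e \<odot> ?f)) + (u $ 2 * v $ 2) *\<^sub>R (\<lambda>x. g x *\<^sub>R (?f \<odot> ?f))"
      by (rule ext) (simp add: vec_eq_iff forall_2 sym_prod_nth axis_def field_simps)
    then show ?thesis
      by (simp only: span_add span_scale that)
  qed
  have "(\<lambda>x. 1 *\<^sub>R (u \<odot> v)) \<in> ?S" for u v
    by (rule expand; rule span_base) (simp_all only: XX_generators_def Let_def list.set insert_iff scaleR_one simp_thms)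
  then have const: "(\<lambda>x. u \<odot> v) \<in> ?S" for u v
    by (simp only: scaleR_one)
  have affine: "(\<lambda>x. x $ 1 *\<^sub>R (u \<odot> v)) \<in> ?S" "(\<lambda>x. x $ 2 *\<^sub>R (u \<odot> v)) \<in> ?S" for u v
    by (rule expand; rule span_base; simp only: XX_generators_def Let_def list.set insert_iff simp_thms)+
  have gen: "(\<lambda>x. x $ 1 *\<^sub>R (x \<odot> ?e)) \<in> ?S" "(\<lambda>x. x $ 1 *\<^sub>R (x \<odot> ?f)) \<in> ?S"
    "(\<lambda>x. x $ 2 *\<^sub>R (x \<odot> ?e)) \<in> ?S" "(\<lambda>x. x $ 2 *\<^sub>R (x \<odot> ?f)) \<in> ?S"
    "(\<lambda>x. x $ 1 *\<^sub>R (x \<odot> x)) \<in> ?S" "(\<lambda>x. x $ 2 *\<^sub>R (x \<odot> x)) \<in> ?S"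
    by (rule span_base; simp only: XX_generators_def Let_def list.set insert_iff simp_thms)+
  have quad: "(\<lambda>x. x $ i *\<^sub>R (x \<odot> u)) \<in> ?S" if "i = 1 \<or> i = 2" for i u
  proof -
    have "(\<lambda>x. x $ i *\<^sub>R (x \<odot> u)) = u $ 1 *\<^sub>R (\<lambda>x. x $ i *\<^sub>R (x \<odot> ?e)) + u $ 2 *\<^sub>R (\<lambda>x. x $ i *\<^sub>R (x \<odot> ?f))"
      by (rule ext) (simp add: vec_eq_iff forall_2 sym_prod_nth axis_def field_simps)
    then show ?thesis
      using that gen by (elim disjE) (simp_all only: span_add span_scale)
  qed
  have "(\<lambda>x. \<phi> x \<odot> \<psi> x) = (\<lambda>x. a \<odot> c) + (\<lambda>x. x $ 1 *\<^sub>R (a \<odot> A)) + (\<lambda>x. x $ 2 *\<^sub>R (a \<odot> B))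
    + \<alpha> *\<^sub>R (\<lambda>x. x $ 1 *\<^sub>R (x \<odot> a)) + \<beta> *\<^sub>R (\<lambda>x. x $ 2 *\<^sub>R (x \<odot> a))
    + b *\<^sub>R (\<lambda>x. x $ 1 *\<^sub>R (?e \<odot> c)) + b *\<^sub>R (\<lambda>x. x $ 2 *\<^sub>R (?f \<odot> c))
    + b *\<^sub>R (\<lambda>x. x $ 1 *\<^sub>R (x \<odot> A)) + b *\<^sub>R (\<lambda>x. x $ 2 *\<^sub>R (x \<odot> B))
    + (b * \<alpha>) *\<^sub>R (\<lambda>x. x $ 1 *\<^sub>R (x \<odot> x)) + (b * \<beta>) *\<^sub>R (\<lambda>x. x $ 2 *\<^sub>R (x \<odot> x))"
    unfolding \<phi> \<psi> by (rule ext) (simp add: vec_eq_iff forall_2 sym_prod_nth axis_def field_simps)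
  then show "M \<in> ?S"
    unfolding M by (simp only: span_add span_scale const affine gen quad simp_thms)
qed

text \<open>A tensor of the space outside the span would extend the 15 basis tensors to 16 independent elements of
a span of 15 fields.\<close>

lemma span_BB:
  assumes z: "pos_triangle z"
  shows "span (BB z) = XX"
proof
  show "span (BB z) \<subseteq> XX"
    by (rule span_minimal[OF BB_subset_XX[OF z] subspace_XX])
  have fin: "finite (BB z)" and card: "card (BB z) = 15"
    using card_image[OF inj_on_basis_tensor[OF z]] by (simp_all add: BB_def finite_dof_indices card_dof_indices)
  show "XX \<subseteq> span (BB z)"
  proof (rule subsetI, rule ccontr)
    fix M assume M: "M \<in> XX" "M \<notin> span (BB z)"
    have ind: "independent (insert M (BB z))"
      by (rule independent_insertI[OF M(2) independent_BB[OF z]])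
    have "insert M (BB z) \<subseteq> span (set XX_generators)"
      using M(1) by (intro subset_trans[OF _ XX_subset_span_generators] insert_subsetI BB_subset_XX[OF z])
    then have "card (insert M (BB z)) \<le> card (set XX_generators)"
      by (rule conjunct2[OF independent_span_bound[OF finite_set ind]])
    moreover have "card (insert M (BB z)) = 16"
    proof -
      have "M \<notin> BB z" using M(2) by (metis span_base)
      then show ?thesis using fin card by simp
    qed
    moreover have "length XX_generators = 15"
      by (simp add: XX_generators_def Let_def)
    then have "card (set XX_generators) \<le> 15"
      by (metis card_length)
    ultimately show False by simp
  qed
qed

section \<open>Geometry of shape-regular triangles\<close>

lemma vertex_in_Tri: "z j \<in> Tri z"
  by (simp add: Tri_def hull_inc)

lemma convex_Tri: "convex (Tri z)" and compact_Tri: "compact (Tri z)"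
  by (simp_all add: Tri_def finite_imp_compact_convex_hull)

lemma bary_convex_combination:
  assumes "u + v = 1"
  shows "bary z j (u *\<^sub>R x + v *\<^sub>R y) = u * bary z j x + v * bary z j y"
proof -
  note l = bounded_linear.linear[OF linear_dbary[of z j]]
  have b: "bary z j w = bary z j 0 + dbary z j w" for w
    using bary_diff[of z j w 0] by simp
  have "bary z j (u *\<^sub>R x + v *\<^sub>R y) = (u + v) * bary z j 0 + (u * dbary z j x + v * dbary z j y)"
    by (simp only: b[of "u *\<^sub>R x + v *\<^sub>R y"] linear_add[OF l] linear_scale[OF l] real_scaleR_def assms mult_1)
  then show ?thesis
    by (simp only: b[of x] b[of y]) (simp add: algebra_simps)
qed

text \<open>A point with nonnegative barycentric coordinates is by their definition a convex combination of the
vertices; conversely the coordinates are affine and nonnegative at the vertices.\<close>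

lemma Tri_eq:
  assumes "pos_triangle z"
  shows "Tri z = {x. \<forall>j. 0 \<le> bary z j x}"
proof
  have "convex {x. \<forall>j. 0 \<le> bary z j x}"
    by (rule convexI) (simp add: bary_convex_combination)
  then show "Tri z \<subseteq> {x. \<forall>j. 0 \<le> bary z j x}"
    unfolding Tri_def by (intro hull_minimal) (auto simp: bary_vertex[OF assms])
  show "{x. \<forall>j. 0 \<le> bary z j x} \<subseteq> Tri z"
  proof
    fix x assume "x \<in> {x. \<forall>j. 0 \<le> bary z j x}"
    then have "(\<Sum>j\<in>UNIV. bary z j x *\<^sub>R z j) \<in> Tri z"
      by (intro convex_sum convex_Tri) (simp_all add: bary_affine[OF assms] vertex_in_Tri)
    then show "x \<in> Tri z" by (simp add: bary_affine[OF assms])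
  qed
qed

lemma bary_bounds:
  assumes "pos_triangle z" "x \<in> Tri z"
  shows "0 \<le> bary z j x" "bary z j x \<le> 1"
proof -
  have b: "0 \<le> bary z k x" for k
    using assms by (simp add: Tri_eq)
  then show "0 \<le> bary z j x" .
  show "bary z j x \<le> 1"
    using bary_affine(1)[OF assms(1), of x] b[of "j + 1"] b[of "j + 2"] by (simp add: sum_cyclic[of _ j])
qed

lemma abs_cross2_le: "\<bar>cross2 u v\<bar> \<le> norm u * norm v"
proof -
  have "cross2 u v = u \<bullet> vector [v $ 2, - (v $ 1)]"
    by (simp add: cross2_def inner_vec_def sum_2)
  moreover have "norm (vector [v $ 2, - (v $ 1)] :: real^2) = norm v"
    by (simp add: norm_vec_def L2_set_def sum_2 add.commute)
  ultimately show ?thesis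
    using Cauchy_Schwarz_ineq2[of u "vector [v $ 2, - (v $ 1)]"] by simp
qed

lemma norm_edge: "norm (edge z j) = len z j"
  by (simp add: edge_def len_def dist_norm norm_minus_commute)

lemma abs_dbary_le:
  assumes "pos_triangle z"
  shows "\<bar>dbary z j h\<bar> \<le> len z (j + 1) / area2 z * norm h"
  using abs_cross2_le[of h "edge z (j + 1)"] area2_pos[OF assms]
  by (simp add: dbary_def norm_edge divide_right_mono mult.commute)

text \<open>Across a disc of radius \<open>r\<close>, in the direction normal to edge \<open>j\<close>, the barycentric coordinate \<open>j + 2\<close>
changes by \<open>2 r\<close> over the height of the triangle. It ranges in \<open>[0, 1]\<close> on the triangle.\<close>

lemma inscribed_disc_bound:
  assumes z: "pos_triangle z" and r: "r \<ge> 0" "cball c r \<subseteq> Tri z"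
  shows "2 * r * len z j \<le> area2 z"
proof -
  let ?n = "nrml z j"
  have n: "norm ?n = 1" by (rule nrml_exterior(2)[OF z])
  have "c + r *\<^sub>R ?n \<in> Tri z" "c - r *\<^sub>R ?n \<in> Tri z"
    using r n by (auto intro!: subsetD[OF r(2)] simp: dist_norm)
  then have "bary z (j + 2) (c - r *\<^sub>R ?n) - bary z (j + 2) (c + r *\<^sub>R ?n) \<le> 1"
    using bary_bounds[OF z, of "c - r *\<^sub>R ?n" "j + 2"] bary_bounds[OF z, of "c + r *\<^sub>R ?n" "j + 2"] by linarith
  moreover have "c - r *\<^sub>R ?n - (c + r *\<^sub>R ?n) = (- 2 * r) *\<^sub>R ?n"
    by (simp add: vec_eq_iff)
  then have "bary z (j + 2) (c - r *\<^sub>R ?n) - bary z (j + 2) (c + r *\<^sub>R ?n) = 2 * r * len z j / area2 z"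
    unfolding bary_diff by (simp only: linear_scale[OF bounded_linear.linear[OF linear_dbary]] dbary_frame[OF z]) simp
  ultimately show ?thesis
    using area2_pos[OF z] by simp
qed

lemma Tri_contains_disc:
  assumes z: "pos_triangle z"
  obtains c r where "r > 0" "cball c r \<subseteq> Tri z"
proof -
  \<comment> \<open>the open interior, which contains the centroid, the image of \<open>(1/3, 1/3)\<close>\<close>
  let ?U = "{x. 0 < bary z 1 x \<and> 0 < bary z 2 x \<and> 0 < bary z 3 x}"
  have "open ?U"
    by (intro open_Collect_conj open_Collect_less continuous_intros)
  moreover have "bary ref_triangle j (vector [1/3, 1/3]) = 1/3" for j
    using exhaust_3[of j]
    by (elim disjE) (simp_all only: three_cyclic bary_def area2_ref, simp_all add: cross2_def ref_triangle_def axis_def)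
  then have "FK z (vector [1/3, 1/3]) \<in> ?U"
    by (simp only: bary_FK[OF z] mem_Collect_eq) simp
  ultimately have "\<exists>r>0. cball (FK z (vector [1/3, 1/3])) r \<subseteq> ?U"
    by (rule open_contains_cball[THEN iffD1, rule_format])
  then obtain r where r: "r > 0" "cball (FK z (vector [1/3, 1/3])) r \<subseteq> ?U"
    by (elim exE conjE)
  have "?U \<subseteq> Tri z"
  proof
    fix x assume "x \<in> ?U"
    then have "0 \<le> bary z j x" for j
      using exhaust_3[of j] by (elim disjE) simp_all
    then show "x \<in> Tri z" unfolding Tri_eq[OF z] by simp
  qed
  then show ?thesis
    by (rule that[OF r(1) subset_trans[OF r(2)]])
qed

definition diam :: "vertices \<Rightarrow> real"
  where "diam z = diameter (Tri z)"

text \<open>The supremum that defines \<open>incircle_diameter\<close> is taken over a nonempty bounded set of reals, and it is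
positive since a nondegenerate triangle has interior points. Some disc in the triangle therefore has more than
half of that diameter.\<close>

lemma incircle:
  assumes z: "pos_triangle z"
  shows "incircle_diameter z > 0" "incircle_diameter z * len z j \<le> area2 z"
    "\<exists>c r. r > incircle_diameter z / 4 \<and> cball c r \<subseteq> Tri z"
proof -
  define S where "S = {2 * r | r c. r \<ge> 0 \<and> cball c r \<subseteq> Tri z}"
  have inc: "incircle_diameter z = Sup S"
    by (simp only: incircle_diameter_def S_def)
  have le: "y \<le> area2 z / len z k" if "y \<in> S" for y k
  proof -
    from that obtain r c where "y = 2 * r" "r \<ge> 0" "cball c r \<subseteq> Tri z" unfolding S_def by blast
    then show ?thesis
      using inscribed_disc_bound[OF z, of r c k] len_pos[OF z, of k] by (simp add: pos_le_divide_eq)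
  qed
  have bdd: "bdd_above S"
    by (rule bdd_aboveI[of _ "area2 z / len z 1"]) (rule le)
  obtain c r where cr: "r > 0" "cball c r \<subseteq> Tri z" by (rule Tri_contains_disc[OF z])
  have S: "2 * r \<in> S"
    unfolding S_def mem_Collect_eq using cr by (intro exI[of _ r] exI[of _ c]) simp
  then have "2 * r \<le> Sup S" by (rule cSup_upper[OF _ bdd])
  then have pos: "Sup S > 0" using cr(1) by linarith
  then show "incircle_diameter z > 0" by (simp only: inc)
  have "Sup S \<le> area2 z / len z j"
    by (rule cSup_least[OF _ le]) (use S in blast)
  then have "Sup S * len z j \<le> area2 z"
    using len_pos[OF z, of j] by (simp only: pos_le_divide_eq)
  then show "incircle_diameter z * len z j \<le> area2 z"
    by (simp only: inc)
  have "Sup S / 2 < Sup S" using pos by linarith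
  then obtain y where y: "y \<in> S" "Sup S / 2 < y"
    using less_cSup_iff[OF _ bdd, of "Sup S / 2"] S by blast
  from y(1) obtain c' r' where r': "y = 2 * r'" "cball c' r' \<subseteq> Tri z" unfolding S_def by blast
  have "r' > incircle_diameter z / 4"
    unfolding inc using y(2) r'(1) by linarith
  with r'(2) show "\<exists>c r. r > incircle_diameter z / 4 \<and> cball c r \<subseteq> Tri z"
    by (intro exI conjI)
qed

lemma dist_le_diam: "x \<in> Tri z \<Longrightarrow> y \<in> Tri z \<Longrightarrow> norm (x - y) \<le> diam z"
  using diameter_bounded_bound[OF compact_imp_bounded[OF compact_Tri]] by (simp add: diam_def dist_norm)

lemma len_le_diam: "len z j \<le> diam z"
  using dist_le_diam[OF vertex_in_Tri vertex_in_Tri, of z j "j + 1"] by (simp add: len_def dist_norm)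

lemma diam_pos: "pos_triangle z \<Longrightarrow> diam z > 0"
  using len_le_diam[of z 1] len_pos[of z 1] by linarith

lemma diam_le_lens: "diam z \<le> len z 1 + len z 2 + len z 3"
proof -
  let ?s = "len z 1 + len z 2 + len z 3"
  have nn: "len z j \<ge> 0" for j by (simp add: len_def)
  have vv: "dist (z k) (z l) \<le> ?s" for k l
  proof -
    have "dist (z k) (z l) \<le> len z k + len z (k + 1) + len z (k + 2)"
      using nn[of k] nn[of "k + 1"] nn[of "k + 2"]
      by (cases rule: cyclic_cases[of l k]) (auto simp: len_def index_shift dist_commute add_increasing)
    also have "\<dots> = ?s"
      using sum_cyclic[of "len z" k] by (simp add: sum_3)
    finally show ?thesis .
  qed
  have sub: "Tri z \<subseteq> cball (z k) ?s" for k
    unfolding Tri_def by (rule hull_minimal) (use vv in auto)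
  have mem: "z k \<in> cball y ?s" if "y \<in> Tri z" for k y
    using subsetD[OF sub that, of k] by (simp add: dist_commute)
  have sub': "Tri z \<subseteq> cball y ?s" if "y \<in> Tri z" for y
    unfolding Tri_def by (rule hull_minimal) (use mem[OF that] in blast, rule convex_cball)
  have "norm (x - y) \<le> ?s" if "x \<in> Tri z" "y \<in> Tri z" for x y
    using subsetD[OF sub'[OF that(1)] that(2)] by (simp add: dist_norm)
  moreover have "0 \<le> ?s"
    using nn[of 1] nn[of 2] nn[of 3] by linarith
  ultimately show ?thesis
    unfolding diam_def by (intro diameter_le) blast+
qed

lemma area2_le: "area2 z \<le> len z j * diam z"
proof -
  have "area2 z = cross2 (edge z (j + 2)) (edge z j)"
    by (simp add: cross2_edges)
  also have "\<dots> \<le> len z (j + 2) * len z j"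
    using abs_cross2_le[of "edge z (j + 2)" "edge z j"] by (simp add: norm_edge)
  also have "\<dots> \<le> diam z * len z j"
    by (intro mult_right_mono len_le_diam) (simp add: len_def)
  finally show ?thesis by (simp add: mult.commute)
qed

text \<open>By \<open>incircle\<close>, bounded shape-regularity gives \<open>h len \<le> \<sigma> D\<close> for each of the three edges, and the
diameter is at most the sum of the three lengths.\<close>

lemma shape_regular:
  assumes z: "pos_triangle z" and s: "shape_regularity z \<le> \<sigma>"
  shows "\<sigma> > 0" "(diam z)\<^sup>2 / area2 z \<le> 3 * \<sigma>" "\<exists>c r. r \<ge> diam z / (4 * \<sigma>) \<and> cball c r \<subseteq> Tri z"
proof -
  note \<rho> = incircle(1)[OF z]
  have h: "diam z \<le> \<sigma> * incircle_diameter z"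
    using s \<rho> by (simp add: shape_regularity_def diam_def field_simps)
  show \<sigma>: "\<sigma> > 0"
    using h \<rho> diam_pos[OF z] by (metis less_le_trans zero_less_mult_pos2)
  have "diam z * len z j \<le> \<sigma> * area2 z" for j
  proof -
    have "diam z * len z j \<le> \<sigma> * incircle_diameter z * len z j"
      using h len_pos[OF z, of j] by (simp add: mult_right_mono)
    also have "\<dots> \<le> \<sigma> * area2 z"
      using incircle(2)[OF z, of j] \<sigma> by (simp add: mult.assoc mult_left_mono)
    finally show ?thesis .
  qed
  from this[of 1] this[of 2] this[of 3]
  have "diam z * (len z 1 + len z 2 + len z 3) \<le> 3 * (\<sigma> * area2 z)"
    by (simp add: distrib_left)
  moreover have "diam z * diam z \<le> diam z * (len z 1 + len z 2 + len z 3)"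
    using diam_le_lens[of z] diam_pos[OF z] by (simp add: mult_left_mono)
  ultimately show "(diam z)\<^sup>2 / area2 z \<le> 3 * \<sigma>"
    using area2_pos[OF z] by (simp add: field_simps power2_eq_square)
  have "diam z / (4 * \<sigma>) \<le> incircle_diameter z / 4"
    using h \<sigma> by (simp add: field_simps)
  then show "\<exists>c r. r \<ge> diam z / (4 * \<sigma>) \<and> cball c r \<subseteq> Tri z"
    using incircle(3)[OF z] by (meson less_imp_le order_trans)
qed

section \<open>Uniformly tame families\<close>

text \<open>A field that depends on the triangle is tame if it is bounded and its Lipschitz constant scales like
\<open>1 / h\<close>, uniformly over all triangles of shape-regularity at most \<open>\<sigma>\<close>. One constant for both bounds makes
the closure properties short.\<close>

definition tame_with :: "real \<Rightarrow> real \<Rightarrow> (vertices \<Rightarrow> real^2 \<Rightarrow> 'b::real_normed_vector) \<Rightarrow> bool"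
  where "tame_with \<sigma> C F \<longleftrightarrow> C \<ge> 0 \<and> (\<forall>z. pos_triangle z \<longrightarrow> shape_regularity z \<le> \<sigma> \<longrightarrow> (\<forall>x\<in>Tri z. norm (F z x) \<le> C \<and>
     (\<forall>y\<in>Tri z. diam z * norm (F z x - F z y) \<le> C * norm (x - y))))"

definition tame :: "real \<Rightarrow> (vertices \<Rightarrow> real^2 \<Rightarrow> 'b::real_normed_vector) \<Rightarrow> bool"
  where "tame \<sigma> F \<longleftrightarrow> (\<exists>C. tame_with \<sigma> C F)"

lemma tame_withD:
  assumes "tame_with \<sigma> C F"
  shows "C \<ge> 0"
    "\<And>z x. pos_triangle z \<Longrightarrow> shape_regularity z \<le> \<sigma> \<Longrightarrow> x \<in> Tri z \<Longrightarrow> norm (F z x) \<le> C"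
    "\<And>z x y. pos_triangle z \<Longrightarrow> shape_regularity z \<le> \<sigma> \<Longrightarrow> x \<in> Tri z \<Longrightarrow> y \<in> Tri z \<Longrightarrow>
       diam z * norm (F z x - F z y) \<le> C * norm (x - y)"
  using assms by (simp_all add: tame_with_def)

lemma tameI:
  assumes "\<And>z x. pos_triangle z \<Longrightarrow> shape_regularity z \<le> \<sigma> \<Longrightarrow> x \<in> Tri z \<Longrightarrow> norm (F z x) \<le> C"
    and "\<And>z x y. pos_triangle z \<Longrightarrow> shape_regularity z \<le> \<sigma> \<Longrightarrow> x \<in> Tri z \<Longrightarrow> y \<in> Tri z \<Longrightarrow>
       diam z * norm (F z x - F z y) \<le> D * norm (x - y)"
  shows "tame \<sigma> F"
  unfolding tame_def tame_with_def
proof (intro exI[of _ "max 0 (max C D)"] conjI allI impI ballI)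
  fix z x assume z: "pos_triangle z" "shape_regularity z \<le> \<sigma>" "x \<in> Tri z"
  show "norm (F z x) \<le> max 0 (max C D)"
    using assms(1)[OF z] by linarith
  fix y assume y: "y \<in> Tri z"
  have "D * norm (x - y) \<le> max 0 (max C D) * norm (x - y)"
    by (rule mult_right_mono) auto
  then show "diam z * norm (F z x - F z y) \<le> max 0 (max C D) * norm (x - y)"
    using assms(2)[OF z y] by linarith
qed simp

lemma tame_const:
  assumes "\<And>z. pos_triangle z \<Longrightarrow> shape_regularity z \<le> \<sigma> \<Longrightarrow> norm (c z) \<le> C"
  shows "tame \<sigma> (\<lambda>z x. c z)"
  by (rule tameI[where C = C and D = 0]) (simp_all add: assms)

lemma tame_cong:
  assumes "tame \<sigma> G" "\<And>z x. pos_triangle z \<Longrightarrow> F z x = G z x"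
  shows "tame \<sigma> F"
  using assms unfolding tame_def tame_with_def by simp

lemma tame_add:
  assumes "tame \<sigma> F" "tame \<sigma> G"
  shows "tame \<sigma> (\<lambda>z x. F z x + G z x)"
proof -
  from assms(1) obtain C where "tame_with \<sigma> C F"
    unfolding tame_def by (elim exE)
  note C = tame_withD[OF this]
  from assms(2) obtain D where "tame_with \<sigma> D G"
    unfolding tame_def by (elim exE)
  note D = tame_withD[OF this]
  show ?thesis
  proof (rule tameI[where C = "C + D" and D = "C + D"])
    fix z x assume z: "pos_triangle z" "shape_regularity z \<le> \<sigma>" "x \<in> Tri z"
    show "norm (F z x + G z x) \<le> C + D"
      by (rule norm_triangle_mono[OF C(2)[OF z] D(2)[OF z]])
    fix y assume y: "y \<in> Tri z"
    have "norm (F z x + G z x - (F z y + G z y)) \<le> norm (F z x - F z y) + norm (G z x - G z y)"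
      by (rule norm_diff_triangle_ineq)
    then have "diam z * norm (F z x + G z x - (F z y + G z y)) \<le> diam z * norm (F z x - F z y) + diam z * norm (G z x - G z y)"
      using diam_pos[OF z(1)] by (simp add: distrib_left[symmetric])
    then show "diam z * norm (F z x + G z x - (F z y + G z y)) \<le> (C + D) * norm (x - y)"
      using C(3)[OF z y] D(3)[OF z y] by (simp add: distrib_right)
  qed
qed

text \<open>The product rule for Lipschitz constants. All tensors below are built from tame factors by
products of this kind.\<close>

lemma tame_bilinear:
  assumes "bounded_bilinear B" "tame \<sigma> F" "tame \<sigma> G"
  shows "tame \<sigma> (\<lambda>z x. B (F z x) (G z x))"
proof -
  interpret bounded_bilinear B by (rule assms(1))
  from nonneg_bounded obtain K where K: "K \<ge> 0" "\<And>a b. norm (B a b) \<le> norm a * norm b * K"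
    by (elim exE conjE) simp
  from assms(2) obtain C where "tame_with \<sigma> C F"
    unfolding tame_def by (elim exE)
  note C = tame_withD[OF this]
  from assms(3) obtain D where "tame_with \<sigma> D G"
    unfolding tame_def by (elim exE)
  note D = tame_withD[OF this]
  show ?thesis
  proof (rule tameI[where C = "C * D * K" and D = "2 * (C * D * K)"])
    fix z x assume z: "pos_triangle z" "shape_regularity z \<le> \<sigma>" "x \<in> Tri z"
    have "norm (F z x) * norm (G z x) * K \<le> C * D * K"
      using C(1) D(1) K(1) C(2)[OF z] D(2)[OF z] by (intro mult_right_mono mult_mono) auto
    then show "norm (B (F z x) (G z x)) \<le> C * D * K"
      using K(2)[of "F z x" "G z x"] by linarith
    fix y assume y: "y \<in> Tri z"
    have "B (F z x) (G z x) - B (F z y) (G z y) = B (F z x - F z y) (G z x) + B (F z y) (G z x - G z y)"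
      by (simp add: diff_left diff_right)
    then have "norm (B (F z x) (G z x) - B (F z y) (G z y)) \<le> norm (B (F z x - F z y) (G z x)) + norm (B (F z y) (G z x - G z y))"
      by (simp add: norm_triangle_ineq)
    also have "\<dots> \<le> norm (F z x - F z y) * norm (G z x) * K + norm (F z y) * norm (G z x - G z y) * K"
      by (intro add_mono K(2))
    also have "\<dots> \<le> norm (F z x - F z y) * D * K + C * norm (G z x - G z y) * K"
      using C(1) D(1) K(1) C(2)[OF z(1,2) y] D(2)[OF z] by (intro add_mono mult_right_mono mult_left_mono) auto
    finally have "diam z * norm (B (F z x) (G z x) - B (F z y) (G z y))
      \<le> diam z * (norm (F z x - F z y) * D * K + C * norm (G z x - G z y) * K)"
      using diam_pos[OF z(1)] by (intro mult_left_mono) auto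
    also have "\<dots> = (diam z * norm (F z x - F z y)) * (D * K) + (diam z * norm (G z x - G z y)) * (C * K)"
      by (simp add: algebra_simps)
    also have "\<dots> \<le> (C * norm (x - y)) * (D * K) + (D * norm (x - y)) * (C * K)"
      using C(1) D(1) K(1) by (intro add_mono mult_right_mono C(3)[OF z y] D(3)[OF z y]) auto
    finally show "diam z * norm (B (F z x) (G z x) - B (F z y) (G z y)) \<le> 2 * (C * D * K) * norm (x - y)"
      by (simp add: algebra_simps)
  qed
qed

lemmas tame_scaleR = tame_bilinear[OF bounded_bilinear_scaleR]
lemmas tame_mult = tame_bilinear[OF bounded_bilinear_mult]
lemmas tame_sym_prod = tame_bilinear[OF bounded_bilinear_sym_prod]

lemma tame_minus:
  assumes "tame \<sigma> F"
  shows "tame \<sigma> (\<lambda>z x. - F z x)"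
  using assms by (simp add: tame_def tame_with_def minus_diff_minus norm_minus_commute)

lemma tame_diff:
  assumes "tame \<sigma> F" "tame \<sigma> G"
  shows "tame \<sigma> (\<lambda>z x. F z x - G z x)"
  using tame_add[OF assms(1) tame_minus[OF assms(2)]] by simp

text \<open>The gradient is at most \<open>h / D\<close>, which is \<open>h\<^sup>2 / D\<close> over \<open>h\<close>.\<close>

lemma tame_bary: "tame \<sigma> (\<lambda>z. bary z j)"
proof (rule tameI[where C = 1 and D = "3 * \<sigma>"])
  fix z x assume z: "pos_triangle z" "shape_regularity z \<le> \<sigma>" "x \<in> Tri z"
  show "norm (bary z j x) \<le> 1"
    using bary_bounds[OF z(1,3), of j] by simp
  fix y
  have "diam z * norm (bary z j x - bary z j y) \<le> diam z * (diam z / area2 z * norm (x - y))"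
    unfolding bary_diff real_norm_def
    using abs_dbary_le[OF z(1), of j "x - y"] len_le_diam[of z "j + 1"] area2_pos[OF z(1)] diam_pos[OF z(1)]
    by (intro mult_left_mono order_trans[OF abs_dbary_le[OF z(1)]] mult_right_mono divide_right_mono) auto
  also have "\<dots> = (diam z)\<^sup>2 / area2 z * norm (x - y)"
    by (simp add: power2_eq_square)
  also have "\<dots> \<le> 3 * \<sigma> * norm (x - y)"
    by (intro mult_right_mono shape_regular(2)[OF z(1,2)]) simp
  finally show "diam z * norm (bary z j x - bary z j y) \<le> 3 * \<sigma> * norm (x - y)" .
qed

lemma tame_position: "tame \<sigma> (\<lambda>z x. (1 / diam z) *\<^sub>R (x - z j))"
proof (rule tameI[where C = 1 and D = 1])
  fix z x assume z: "pos_triangle z" "shape_regularity z \<le> \<sigma>" "x \<in> Tri z"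
  show "norm ((1 / diam z) *\<^sub>R (x - z j)) \<le> 1"
    using dist_le_diam[OF z(3) vertex_in_Tri] diam_pos[OF z(1)] by simp
  fix y
  have "(1 / diam z) *\<^sub>R (x - z j) - (1 / diam z) *\<^sub>R (y - z j) = (1 / diam z) *\<^sub>R (x - y)"
    by (simp add: scaleR_diff_right[symmetric])
  then show "diam z * norm ((1 / diam z) *\<^sub>R (x - z j) - (1 / diam z) *\<^sub>R (y - z j)) \<le> 1 * norm (x - y)"
    using diam_pos[OF z(1)] by simp
qed

lemma tame_edge: "tame \<sigma> (\<lambda>z x. (1 / diam z) *\<^sub>R edge z j)"
proof (rule tame_const)
  show "norm ((1 / diam z) *\<^sub>R edge z j) \<le> 1" if "pos_triangle z" for z
    using len_le_diam[of z j] diam_pos[OF that] by (simp add: norm_edge)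
qed

text \<open>The ratio \<open>h\<^sup>2 / D\<close> is what shape-regularity controls; every dependence of the bounds on \<open>\<sigma>\<close>
enters through it.\<close>

lemma tame_aspect: "tame \<sigma> (\<lambda>z x. (diam z)\<^sup>2 / area2 z)"
proof (rule tame_const)
  fix z assume "pos_triangle z" "shape_regularity z \<le> \<sigma>"
  then show "norm ((diam z)\<^sup>2 / area2 z) \<le> 3 * \<sigma>"
    using shape_regular(2)[of z \<sigma>] area2_pos[of z] by simp
qed

text \<open>The factor \<open>1 / D\<close> is distributed as \<open>h\<^sup>2 / D\<close> times \<open>1 / h\<close> for each of the two position vectors.\<close>

lemma tame_T_tri_0: "tame \<sigma> (\<lambda>z. T_tri z j 0)"
proof (rule tame_cong)
  show "tame \<sigma> (\<lambda>z x. - (((diam z)\<^sup>2 / area2 z * bary z (j + 2) x) *\<^sub>R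
    (((1 / diam z) *\<^sub>R (x - z (j + 2))) \<odot> ((1 / diam z) *\<^sub>R (x - z (j + 2))))))"
    by (intro tame_minus tame_scaleR tame_mult tame_sym_prod tame_aspect tame_bary tame_position)
  show "T_tri z j 0 x = - (((diam z)\<^sup>2 / area2 z * bary z (j + 2) x) *\<^sub>R
    (((1 / diam z) *\<^sub>R (x - z (j + 2))) \<odot> ((1 / diam z) *\<^sub>R (x - z (j + 2)))))" if "pos_triangle z" for z x
    using diam_pos[OF that] unfolding T_tri_0[OF that]
    by (simp only: bounded_bilinear.scaleR_left[OF bounded_bilinear_sym_prod] bounded_bilinear.scaleR_right[OF bounded_bilinear_sym_prod])
       (simp add: power2_eq_square)
qed

lemma tame_T_tri_1: "tame \<sigma> (\<lambda>z. T_tri z j 1)"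
proof (rule tame_cong)
  show "tame \<sigma> (\<lambda>z x. ((diam z)\<^sup>2 / area2 z) *\<^sub>R (((1 / diam z) *\<^sub>R (x - z (j + 2))) \<odot>
    (bary z (j + 1) x *\<^sub>R ((1 / diam z) *\<^sub>R (x - z (j + 1))) - bary z j x *\<^sub>R ((1 / diam z) *\<^sub>R (x - z j)))))"
    by (intro tame_diff tame_scaleR tame_sym_prod tame_aspect tame_bary tame_position)
  show "T_tri z j 1 x = ((diam z)\<^sup>2 / area2 z) *\<^sub>R (((1 / diam z) *\<^sub>R (x - z (j + 2))) \<odot>
    (bary z (j + 1) x *\<^sub>R ((1 / diam z) *\<^sub>R (x - z (j + 1))) - bary z j x *\<^sub>R ((1 / diam z) *\<^sub>R (x - z j))))"
    if "pos_triangle z" for z x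
  proof -
    have "bary z (j + 1) x *\<^sub>R ((1 / diam z) *\<^sub>R (x - z (j + 1))) - bary z j x *\<^sub>R ((1 / diam z) *\<^sub>R (x - z j))
      = (1 / diam z) *\<^sub>R (bary z (j + 1) x *\<^sub>R (x - z (j + 1)) - bary z j x *\<^sub>R (x - z j))"
      by (simp add: scaleR_diff_right mult.commute)
    then show ?thesis
      using diam_pos[OF that] unfolding T_tri_1[OF that]
      by (simp only: bounded_bilinear.scaleR_left[OF bounded_bilinear_sym_prod] bounded_bilinear.scaleR_right[OF bounded_bilinear_sym_prod])
         (simp add: power2_eq_square)
  qed
qed

lemma tame_corner: "tame \<sigma> (\<lambda>z. corner_tensor z j)"
proof (rule tame_cong)
  show "tame \<sigma> (\<lambda>z x. - (((diam z)\<^sup>2 / area2 z * bary z j x) *\<^sub>R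
    (((1 / diam z) *\<^sub>R edge z j) \<odot> ((1 / diam z) *\<^sub>R edge z (j + 2)))))"
    by (intro tame_minus tame_scaleR tame_mult tame_sym_prod tame_aspect tame_bary tame_edge)
  show "corner_tensor z j x = - (((diam z)\<^sup>2 / area2 z * bary z j x) *\<^sub>R
    (((1 / diam z) *\<^sub>R edge z j) \<odot> ((1 / diam z) *\<^sub>R edge z (j + 2))))" if "pos_triangle z" for z x
    using diam_pos[OF that] unfolding corner_tensor_def by (simp add: sym_prod_bilinear power2_eq_square)
qed

lemma tame_J_tri: "tame \<sigma> (\<lambda>z. J_tri z j)"
proof (rule tame_cong)
  show "tame \<sigma> (\<lambda>z x. corner_tensor z j x - (T_tri z j 0 x - T_tri z (j + 1) 0 x + T_tri z (j + 2) 0 x))"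
    by (intro tame_diff tame_add tame_corner tame_T_tri_0)
qed (simp add: J_tri_eq)

lemma tame_N_pre: "tame \<sigma> (\<lambda>z. N_pre z j k)"
proof (rule tame_cong)
  let ?w = "\<lambda>z x. if k = 0 then 1 else bary z (j + 1) x - bary z j x"
  let ?F = "\<lambda>z x. - (((len z j / diam z * (len z j / diam z)) * ((diam z)\<^sup>2 / area2 z * ((diam z)\<^sup>2 / area2 z)) * ?w z x) *\<^sub>R
    (((1 / diam z) *\<^sub>R edge z (j + 1)) \<odot> ((1 / diam z) *\<^sub>R edge z (j + 2))))"
  have "tame \<sigma> ?w"
  proof (cases "k = 0")
    case True
    then show ?thesis using tame_const[of \<sigma> "\<lambda>z. 1 :: real" 1] by simp
  next
    case False
    then show ?thesis using tame_diff[OF tame_bary tame_bary] by simp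
  qed
  moreover have "tame \<sigma> (\<lambda>z x. len z j / diam z)"
  proof (rule tame_const)
    show "norm (len z j / diam z) \<le> 1" if "pos_triangle z" for z
      using len_le_diam[of z j] diam_pos[OF that] len_pos[OF that, of j] by simp
  qed
  ultimately show "tame \<sigma> ?F"
    by (intro tame_minus tame_scaleR tame_mult tame_sym_prod tame_aspect tame_edge)
  show "N_pre z j k x = ?F z x" if "pos_triangle z" for z x
    using diam_pos[OF that] unfolding N_pre_eq[OF that] by (simp add: sym_prod_bilinear power2_eq_square)
qed

lemma abs_inner_matrix_le:
  fixes M :: "real^2^2"
  shows "\<bar>p \<bullet> (M *v q)\<bar> \<le> norm p * norm q * norm M"
proof -
  have "p \<bullet> (M *v q) = outer p q \<bullet> M"
    by (simp add: inner_vec_def matrix_vector_mult_def outer_def sum_2 algebra_simps)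
  then show ?thesis
    using Cauchy_Schwarz_ineq2[of "outer p q" M] by (simp add: norm_outer)
qed

lemma abs_frame_le:
  assumes "pos_triangle z"
  shows "\<bar>nrml z j \<bullet> (M *v nrml z j)\<bar> \<le> norm M" "\<bar>tang z j \<bullet> (M *v nrml z j)\<bar> \<le> norm M"
    "\<bar>nrml z j \<bullet> (M *v tang z j)\<bar> \<le> norm M" "\<bar>tang z j \<bullet> (M *v tang z j)\<bar> \<le> norm M"
  using abs_inner_matrix_le[of "nrml z j" M "nrml z j"] abs_inner_matrix_le[of "tang z j" M "nrml z j"]
    abs_inner_matrix_le[of "nrml z j" M "tang z j"] abs_inner_matrix_le[of "tang z j" M "tang z j"]
  by (simp_all add: nrml_exterior(1,2)[OF assms])

lemma abs_jump_le:
  assumes "pos_triangle z"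
  shows "\<bar>jump z l M\<bar> \<le> 2 * norm (M (z l))"
  using abs_frame_le(2)[OF assms, of "l - 1" "M (z l)"] abs_frame_le(2)[OF assms, of l "M (z l)"]
  unfolding jump_def tr_tn_def by linarith

lemma tame_jump_N_pre: "tame \<sigma> (\<lambda>z x. dof z (Jmp l) (N_pre z j k))"
proof -
  obtain C where "tame_with \<sigma> C (\<lambda>z. N_pre z j k)"
    using tame_N_pre[of \<sigma> j k] unfolding tame_def by (elim exE)
  note C = tame_withD[OF this]
  show ?thesis
  proof (rule tame_const)
    fix z assume z: "pos_triangle z" "shape_regularity z \<le> \<sigma>"
    show "norm (dof z (Jmp l) (N_pre z j k)) \<le> 2 * C"
      using abs_jump_le[OF z(1), of l "N_pre z j k"] C(2)[OF z vertex_in_Tri, of l] by simp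
  qed
qed

text \<open>The tangential trace consists of three frame components of the derivative, each of which is at most
\<open>len\<^sup>2 / D\<^sup>2\<close> times \<open>2 h / D\<close> times \<open>h\<^sup>2\<close>. Integration over the edge contributes another factor \<open>h\<close>, so the
powers of \<open>h\<close> and \<open>D\<close> match those of \<open>(h\<^sup>2 / D)\<^sup>3\<close>.\<close>

lemma tame_moment_N_pre: "tame \<sigma> (\<lambda>z x. dof z (Tan l 0) (N_pre z j k))"
proof (rule tame_const)
  fix z assume z: "pos_triangle z" "shape_regularity z \<le> \<sigma>"
  let ?h = "diam z" and ?D = "area2 z"
  let ?M = "\<lambda>h. - ((len z j)\<^sup>2 / ?D\<^sup>2 * (if k = 0 then 0 else dbary z (j + 1) h - dbary z j h))
    *\<^sub>R (edge z (j + 1) \<odot> edge z (j + 2))"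
  note h = diam_pos[OF z(1)] and D = area2_pos[OF z(1)]
  note L = len_pos[OF z(1)] and Lh = len_le_diam[of z]
  have M: "norm (?M v) \<le> 2 * (?h\<^sup>2 / ?D)^3 / ?h" if "norm v = 1" for v
  proof -
    have d: "\<bar>dbary z i v\<bar> \<le> ?h / ?D" for i
      using abs_dbary_le[OF z(1), of i v] divide_right_mono[OF Lh[of "i + 1"], of ?D] D that by simp
    have "\<bar>if k = 0 then 0 else dbary z (j + 1) v - dbary z j v\<bar> \<le> 2 * (?h / ?D)"
      using d[of "j + 1"] d[of j] h D by (auto simp: abs_le_iff)
    moreover have "norm (edge z (j + 1) \<odot> edge z (j + 2)) \<le> ?h * ?h"
      using norm_sym_prod_le[of "edge z (j + 1)" "edge z (j + 2)"] mult_mono[OF Lh[of "j + 1"] Lh[of "j + 2"]] L[of "j + 2"] h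
      unfolding norm_edge by simp
    moreover have "(len z j)\<^sup>2 / ?D\<^sup>2 \<le> ?h\<^sup>2 / ?D\<^sup>2"
      using Lh[of j] L[of j] by (intro divide_right_mono power_mono) auto
    ultimately have "(len z j)\<^sup>2 / ?D\<^sup>2 * \<bar>if k = 0 then 0 else dbary z (j + 1) v - dbary z j v\<bar> * norm (edge z (j + 1) \<odot> edge z (j + 2))
      \<le> ?h\<^sup>2 / ?D\<^sup>2 * (2 * (?h / ?D)) * (?h * ?h)"
      using h D by (intro mult_mono) auto
    also have "\<dots> = 2 * (?h\<^sup>2 / ?D)^3 / ?h"
      using h D by (simp add: field_simps power2_eq_square power3_eq_cube)
    finally show ?thesis
      by (simp only: norm_scaleR abs_minus_cancel abs_mult abs_divide abs_power2)
  qed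
  have "\<bar>tr_t z l (N_pre z j k) 0\<bar> \<le> 3 * (2 * (?h\<^sup>2 / ?D)^3 / ?h)"
    unfolding tr_t_eq[OF z(1) N_pre_has_derivative[OF z(1)]]
    using M[of "tang z l"] M[of "nrml z l"] nrml_exterior(1,2)[OF z(1), of l]
      abs_frame_le[OF z(1), of l "?M (tang z l)"] abs_frame_le(1)[OF z(1), of l "?M (nrml z l)"]
    by linarith
  then have "len z l * \<bar>tr_t z l (N_pre z j k) 0\<bar> \<le> ?h * (3 * (2 * (?h\<^sup>2 / ?D)^3 / ?h))"
    using Lh[of l] L[of l] h by (intro mult_mono) auto
  also have "\<dots> = 6 * (?h\<^sup>2 / ?D)^3"
    using h by simp
  also have "\<dots> \<le> 6 * (3 * \<sigma>)^3"
    using shape_regular(2)[OF z] h D by (intro mult_left_mono power_mono) auto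
  finally have "len z l * \<bar>tr_t z l (N_pre z j k) 0\<bar> \<le> 6 * (3 * \<sigma>)^3" .
  moreover have "tr_t z l (N_pre z j k) (edge_at z l s) = tr_t z l (N_pre z j k) 0 + 0 * (s / len z l)" for s
    using tr_t_N_pre(1)[OF z(1)] by simp
  from dof_Tan_affine(1)[OF z(1) this]
  have "dof z (Tan l 0) (N_pre z j k) = len z l * tr_t z l (N_pre z j k) 0"
    by (simp only: div_0 add_0_right)
  ultimately show "norm (dof z (Tan l 0) (N_pre z j k)) \<le> 6 * (3 * \<sigma>)^3"
    using L[of l] by (simp add: abs_mult del: dof.simps)
qed

lemma N_tri_apply:
  assumes "pos_triangle z" "k \<in> {0, 1}"
  shows "N_tri z j k x = N_pre z j k x
    - (dof z (Tan 1 0) (N_pre z j k) *\<^sub>R T_tri z 1 0 x + dof z (Tan 2 0) (N_pre z j k) *\<^sub>R T_tri z 2 0 x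
       + dof z (Tan 3 0) (N_pre z j k) *\<^sub>R T_tri z 3 0 x)
    - (dof z (Jmp 1) (N_pre z j k) *\<^sub>R J_tri z 1 x + dof z (Jmp 2) (N_pre z j k) *\<^sub>R J_tri z 2 x
       + dof z (Jmp 3) (N_pre z j k) *\<^sub>R J_tri z 3 x)"
  unfolding N_tri_eq[OF assms] by (simp add: sum_3 del: dof.simps)

lemma tame_basis_tensor:
  assumes "i \<in> dof_indices"
  shows "tame \<sigma> (\<lambda>z. basis_tensor z i)"
  using assms
proof (cases rule: dof_index_cases)
  case (1 j k)
  show ?thesis
  proof (rule tame_cong)
    show "tame \<sigma> (\<lambda>z x. N_pre z j k x
      - (dof z (Tan 1 0) (N_pre z j k) *\<^sub>R T_tri z 1 0 x + dof z (Tan 2 0) (N_pre z j k) *\<^sub>R T_tri z 2 0 x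
         + dof z (Tan 3 0) (N_pre z j k) *\<^sub>R T_tri z 3 0 x)
      - (dof z (Jmp 1) (N_pre z j k) *\<^sub>R J_tri z 1 x + dof z (Jmp 2) (N_pre z j k) *\<^sub>R J_tri z 2 x
         + dof z (Jmp 3) (N_pre z j k) *\<^sub>R J_tri z 3 x))"
      by (intro tame_diff tame_add tame_scaleR tame_N_pre tame_T_tri_0 tame_J_tri tame_jump_N_pre tame_moment_N_pre)
  qed (simp only: 1 basis_tensor.simps N_tri_apply)
next
  case (2 j k)
  then have "k = 0 \<or> k = 1" by simp
  with 2 show ?thesis
    using tame_T_tri_0[of \<sigma> j] tame_T_tri_1[of \<sigma> j] by (elim disjE) (simp_all only: basis_tensor.simps)
next
  case (3 j)
  then show ?thesis using tame_J_tri[of \<sigma> j] by simp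
qed

section \<open>Two-sided bounds for the norms\<close>

lemma integrable_on_compact:
  fixes f :: "real^2 \<Rightarrow> real"
  assumes "continuous_on S f" "compact S"
  shows "f integrable_on S"
proof -
  have "set_integrable lborel S f"
    unfolding set_integrable_def by (intro borel_integrable_compact assms)
  then show ?thesis
    by (rule set_borel_integral_eq_integral(1))
qed

lemma has_integral_disc:
  fixes c :: "real^2"
  assumes "r \<ge> 0"
  shows "((\<lambda>x. k) has_integral (k * (pi * r\<^sup>2))) (cball c r)"
proof -
  have "((\<lambda>x. 1) has_integral measure lborel (cball c r)) (cball c r)"
    by (rule has_integral_measure_lborel) (simp_all add: emeasure_bounded_finite[unfolded infinity_ennreal_def])
  moreover have "measure lborel (cball c r) = pi * r\<^sup>2"
    using content_cball[OF assms, of c] by (simp add: unit_ball_vol_2)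
  ultimately have "((\<lambda>x. k * 1) has_integral (k * (pi * r\<^sup>2))) (cball c r)"
    by (intro has_integral_mult_right) simp
  then show ?thesis by simp
qed

lemma L2_norm_le:
  assumes "continuous_on UNIV M" "\<And>x. x \<in> Tri z \<Longrightarrow> norm (M x) \<le> C" "C \<ge> 0" "diam z \<ge> 0"
  shows "L2_norm z M \<le> C * sqrt pi * diam z"
proof -
  have c: "continuous_on S M" for S
    using assms(1) by (rule continuous_on_subset) simp
  have "Tri z \<subseteq> cball (z 1) (diam z)"
    using dist_le_diam[OF vertex_in_Tri] by (auto simp: dist_norm)
  then have "integral (Tri z) (\<lambda>x. C\<^sup>2) \<le> integral (cball (z 1) (diam z)) (\<lambda>x. C\<^sup>2)"
    by (intro integral_subset_le integrable_on_compact compact_Tri compact_cball continuous_on_const) simp_all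
  moreover have "integral (Tri z) (\<lambda>x. (norm (M x))\<^sup>2) \<le> integral (Tri z) (\<lambda>x. C\<^sup>2)"
    using assms(2,3) by (intro integral_le integrable_on_compact compact_Tri continuous_intros c) (auto intro!: power_mono)
  ultimately have "integral (Tri z) (\<lambda>x. (norm (M x))\<^sup>2) \<le> C\<^sup>2 * (pi * (diam z)\<^sup>2)"
    using integral_unique[OF has_integral_disc[OF assms(4), of "C\<^sup>2" "z 1"]] by simp
  then have "L2_norm z M \<le> sqrt (C\<^sup>2 * (pi * (diam z)\<^sup>2))"
    unfolding L2_norm_def by (rule real_sqrt_le_mono)
  also have "\<dots> = C * sqrt pi * diam z"
    using assms(3,4) by (simp add: real_sqrt_mult)
  finally show ?thesis .
qed

lemma L2_norm_ge:
  assumes "continuous_on UNIV M" "cball p r \<subseteq> Tri z" "\<And>x. x \<in> cball p r \<Longrightarrow> c \<le> norm (M x)" "c \<ge> 0" "r \<ge> 0"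
  shows "c * sqrt pi * r \<le> L2_norm z M"
proof -
  have cont: "continuous_on S M" for S
    using assms(1) by (rule continuous_on_subset) simp
  have "c\<^sup>2 * (pi * r\<^sup>2) = integral (cball p r) (\<lambda>x. c\<^sup>2)"
    using integral_unique[OF has_integral_disc[OF assms(5)]] by simp
  also have "\<dots> \<le> integral (cball p r) (\<lambda>x. (norm (M x))\<^sup>2)"
    using assms(3,4)
    by (intro integral_le integrable_on_compact compact_cball continuous_intros cont) (auto intro!: power_mono)
  also have "\<dots> \<le> integral (Tri z) (\<lambda>x. (norm (M x))\<^sup>2)"
    by (intro integral_subset_le assms(2) integrable_on_compact compact_Tri compact_cball continuous_intros cont) simp
  finally have "sqrt (c\<^sup>2 * (pi * r\<^sup>2)) \<le> L2_norm z M"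
    unfolding L2_norm_def by (rule real_sqrt_le_mono)
  then show ?thesis
    using assms(4,5) by (simp add: real_sqrt_mult)
qed

text \<open>The triangle shrunk by the factor \<open>\<delta>\<close> towards \<open>x\<^sub>0\<close> stays inside the triangle by convexity, all of its points
are within \<open>\<delta> h\<close> of \<open>x\<^sub>0\<close>, and it contains the inscribed disc shrunk by the same factor. For small
\<open>\<delta>\<close> the Lipschitz bound keeps the field above \<open>c / 2\<close> there.\<close>

lemma L2_norm_lower_bound:
  assumes z: "pos_triangle z" "shape_regularity z \<le> \<sigma>" and F: "tame_with \<sigma> C F" "continuous_on UNIV (F z)"
    and x\<^sub>0: "x\<^sub>0 \<in> Tri z" "c \<le> norm (F z x\<^sub>0)" and c: "0 < c"
  shows "c / 2 * sqrt pi * (min 1 (c / (2 * (C + 1))) / (4 * \<sigma>)) * diam z \<le> L2_norm z (F z)"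
proof -
  define \<delta> where "\<delta> = min 1 (c / (2 * (C + 1)))"
  note C = tame_withD[OF F(1)]
  have h: "diam z > 0" by (rule diam_pos[OF z(1)])
  have \<delta>: "0 < \<delta>" "\<delta> \<le> 1" "C * \<delta> \<le> c / 2"
  proof -
    show d: "0 < \<delta>" "\<delta> \<le> 1" using c C(1) by (simp_all add: \<delta>_def)
    have "(C + 1) * \<delta> \<le> (C + 1) * (c / (2 * (C + 1)))"
      using C(1) by (intro mult_left_mono) (simp_all add: \<delta>_def)
    also have "\<dots> = c / 2"
      using C(1) by (simp add: nonzero_eq_divide_eq[of "2 * (C + 1)"] field_simps)
    finally show "C * \<delta> \<le> c / 2" using d by (simp add: distrib_right)
  qed
  define r where "r = diam z / (4 * \<sigma>)"
  have r: "r > 0" using h shape_regular(1)[OF z] by (simp add: r_def)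
  obtain p r' where "r \<le> r'" "cball p r' \<subseteq> Tri z"
    using shape_regular(3)[OF z] unfolding r_def by (elim exE conjE)
  then have p: "cball p r \<subseteq> Tri z" by (meson subset_cball subset_trans)
  let ?q = "x\<^sub>0 + \<delta> *\<^sub>R (p - x\<^sub>0)"
  have ball: "y \<in> Tri z \<and> c / 2 \<le> norm (F z y)" if "y \<in> cball ?q (\<delta> * r)" for y
  proof -
    \<comment> \<open>the point that the contraction towards \<open>x\<^sub>0\<close> moves to \<open>y\<close>\<close>
    define w where "w = x\<^sub>0 + (1 / \<delta>) *\<^sub>R (y - x\<^sub>0)"
    have "\<delta> *\<^sub>R (p - w) = ?q - y"
      using \<delta>(1) by (simp add: w_def scaleR_diff_right scaleR_add_right)
    then have "\<delta> * norm (p - w) = norm (?q - y)"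
      using \<delta>(1) by (metis abs_of_pos norm_scaleR)
    also have "\<dots> \<le> \<delta> * r"
      using that by (simp add: dist_norm)
    finally have w: "w \<in> Tri z"
      using \<delta>(1) by (intro subsetD[OF p]) (simp add: dist_norm)
    have y: "y = (1 - \<delta>) *\<^sub>R x\<^sub>0 + \<delta> *\<^sub>R w"
      using \<delta>(1) by (simp add: w_def scaleR_add_right scaleR_diff_left)
    then have yT: "y \<in> Tri z"
      using convexD[OF convex_Tri x\<^sub>0(1) w, of "1 - \<delta>" \<delta>] \<delta> by simp
    have "x\<^sub>0 - y = \<delta> *\<^sub>R (x\<^sub>0 - w)"
      by (simp add: y scaleR_diff_left scaleR_diff_right)
    then have "norm (x\<^sub>0 - y) \<le> \<delta> * diam z"
      using dist_le_diam[OF x\<^sub>0(1) w] \<delta>(1) by simp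
    then have "diam z * norm (F z x\<^sub>0 - F z y) \<le> C * (\<delta> * diam z)"
      using C(3)[OF z x\<^sub>0(1) yT] C(1) by (meson mult_left_mono order_trans)
    also have "\<dots> \<le> diam z * (c / 2)"
      using mult_left_mono[OF \<delta>(3), of "diam z"] h by (simp add: mult_ac)
    finally have "norm (F z x\<^sub>0 - F z y) \<le> c / 2"
      using h by simp
    then have "c / 2 \<le> norm (F z y)"
      using x\<^sub>0(2) norm_triangle_ineq2[of "F z x\<^sub>0" "F z y"] by linarith
    with yT show ?thesis ..
  qed
  have "c / 2 * sqrt pi * (\<delta> * r) \<le> L2_norm z (F z)"
  proof (rule L2_norm_ge[OF F(2)])
    show "cball ?q (\<delta> * r) \<subseteq> Tri z"
      by (rule subsetI) (rule conjunct1[OF ball])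
  qed (use ball \<delta>(1) r c in simp_all)
  then show ?thesis
    by (simp add: r_def \<delta>_def mult_ac)
qed

lemma edge_at_in_Tri:
  assumes "pos_triangle z" "0 \<le> s" "s \<le> len z l"
  shows "edge_at z l s \<in> Tri z"
proof -
  have "0 \<le> bary z k (edge_at z l s)" for k
    using assms(2,3) len_pos[OF assms(1), of l]
    by (cases rule: cyclic_cases[of k l]) (simp_all add: bary_edge_at[OF assms(1)])
  then show ?thesis by (simp add: Tri_eq[OF assms(1)])
qed

text \<open>At the midpoint of edge \<open>l\<close> the position vectors from both ends are \<open>\<plusminus>(len / 2) t\<close> and the barycentric
coordinates of both ends are \<open>1/2\<close>, so both tensors are the same multiple of \<open>t \<odot> t\<close>.\<close>

lemma norm_T_tri_midpoint:
  assumes z: "pos_triangle z" and k: "k \<in> {0, 1}"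
  shows "norm (T_tri z (l + 2) k (edge_at z l (len z l / 2))) = (len z l)\<^sup>2 / (8 * area2 z)"
proof -
  note L = len_pos[OF z, of l] and D = area2_pos[OF z]
  have t: "norm (tang z l \<odot> tang z l) = 1"
    using nrml_exterior(1)[OF z, of l] by (simp add: sym_prod_self norm_outer)
  have "T_tri z (l + 2) 0 (edge_at z l (len z l / 2)) = (- ((len z l)\<^sup>2 / (8 * area2 z))) *\<^sub>R (tang z l \<odot> tang z l)"
    unfolding T_tri_0[OF z] index_shift
    unfolding edge_at_diff[OF z] bary_edge_at[OF z]
    unfolding sym_prod_bilinear scaleR_scaleR
    using L D by (intro arg_cong[where f = "\<lambda>a. a *\<^sub>R _"]) (simp add: field_simps power2_eq_square)
  then have "norm (T_tri z (l + 2) 0 (edge_at z l (len z l / 2))) = (len z l)\<^sup>2 / (8 * area2 z)"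
    using D by (simp add: t)
  moreover have "T_tri z (l + 2) 1 (edge_at z l (len z l / 2)) = (- ((len z l)\<^sup>2 / (8 * area2 z))) *\<^sub>R (tang z l \<odot> tang z l)"
    unfolding T_tri_1[OF z] index_shift
    unfolding edge_at_diff[OF z] bary_edge_at[OF z] scaleR_zero_left diff_0_right
    unfolding sym_prod_bilinear scaleR_scaleR
    using L D by (intro arg_cong[where f = "\<lambda>a. a *\<^sub>R _"]) (simp add: field_simps power2_eq_square)
  then have "norm (T_tri z (l + 2) 1 (edge_at z l (len z l / 2))) = (len z l)\<^sup>2 / (8 * area2 z)"
    using D by (simp add: t)
  ultimately show ?thesis
    using k by (metis insertE singletonD)
qed

text \<open>Since \<open>D \<le> len h\<close>, the square of \<open>D\<close> is at most \<open>len\<^sup>2 h\<^sup>2 \<le> len\<^sup>2 (3 \<sigma> D)\<close>.\<close>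

lemma len_area_lower_bound:
  assumes z: "pos_triangle z" "shape_regularity z \<le> \<sigma>"
  shows "1 / (24 * \<sigma>) \<le> (len z l)\<^sup>2 / (8 * area2 z)"
proof -
  note D = area2_pos[OF z(1)] and \<sigma> = shape_regular(1)[OF z]
  have "area2 z * area2 z \<le> (len z l * diam z) * (len z l * diam z)"
    using area2_le[of z l] D by (intro mult_mono) auto
  also have "\<dots> = (len z l)\<^sup>2 * (diam z)\<^sup>2"
    by (simp add: power2_eq_square)
  also have "\<dots> \<le> (len z l)\<^sup>2 * (3 * \<sigma> * area2 z)"
    using shape_regular(2)[OF z] D by (intro mult_left_mono) (simp_all add: field_simps)
  finally have "area2 z \<le> 3 * \<sigma> * (len z l)\<^sup>2"
    using D by (simp add: mult_ac)
  then show ?thesis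
    using D \<sigma> by (simp add: field_simps)
qed

lemma tr_n_J_tri:
  assumes z: "pos_triangle z"
  shows "tr_n z l (J_tri z j) (edge_at z l s) = 0"
  using tr_n_corner[OF z, of l j s] tr_n_T_tri[OF z, of 0 l _ s]
  by (simp add: tr_n_def J_tri_eq[OF z] inner_matrix_linear)

lemma tr_n_N_tri:
  assumes z: "pos_triangle z" and k: "k \<in> {0, 1}"
  shows "tr_n z l (N_tri z j k) (edge_at z l s) = tr_n z l (N_pre z j k) (edge_at z l s)"
  using tr_n_J_tri[OF z, of l _ s] tr_n_T_tri[OF z, of 0 l _ s]
  by (simp add: tr_n_def N_tri_apply[OF z k] inner_matrix_linear del: dof.simps)

text \<open>A trace in unit directions is bounded by the norm of the tensor. For \<open>N\<close> and \<open>J\<close> a trace or a jump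
at a vertex has the value \<open>1\<close>; the tensors \<open>T\<close> vanish at the vertices, so for them
the midpoint of the edge \<open>j + 1\<close> is used.\<close>

lemma basis_tensor_large_somewhere:
  assumes z: "pos_triangle z" "shape_regularity z \<le> \<sigma>" and i: "i \<in> dof_indices"
  shows "\<exists>x\<in>Tri z. min (1/2) (1 / (24 * \<sigma>)) \<le> norm (basis_tensor z i x)"
  using i
proof (cases rule: dof_index_cases)
  case (1 j k)
  note L = len_pos[OF z(1), of j]
  have "tr_n z j (N_tri z j k) (edge_at z j (len z j)) = 1"
    using 1(2) L by (auto simp: tr_n_N_tri[OF z(1)] tr_n_N_pre[OF z(1)])
  then have "1 \<le> norm (N_tri z j k (edge_at z j (len z j)))"
    using abs_frame_le(1)[OF z(1), of j "N_tri z j k (edge_at z j (len z j))"] unfolding tr_n_def by linarith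
  moreover have "edge_at z j (len z j) \<in> Tri z"
    using L by (intro edge_at_in_Tri[OF z(1)]) auto
  ultimately show ?thesis
    unfolding 1(1) basis_tensor.simps by (intro bexI[of _ "edge_at z j (len z j)"]) auto
next
  case (2 j k)
  let ?x = "edge_at z (j + 1) (len z (j + 1) / 2)"
  have "1 / (24 * \<sigma>) \<le> norm (T_tri z j k ?x)"
    using norm_T_tri_midpoint[OF z(1) 2(2), of "j + 1"] len_area_lower_bound[OF z, of "j + 1"] by (simp add: index_shift)
  moreover have "?x \<in> Tri z"
    using len_pos[OF z(1), of "j + 1"] by (intro edge_at_in_Tri[OF z(1)]) auto
  ultimately show ?thesis
    unfolding 2(1) basis_tensor.simps by (intro bexI[of _ ?x]) auto
next
  case (3 j)
  have "jump z j (J_tri z j) = 1"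
    using dof_J_tri[OF z(1) i[unfolded 3], of j] by simp
  then have "1 / 2 \<le> norm (J_tri z j (z j))"
    using abs_jump_le[OF z(1), of j "J_tri z j"] by linarith
  then show ?thesis
    unfolding 3 basis_tensor.simps by (intro bexI[of _ "z j"] vertex_in_Tri) auto
qed

text \<open>For \<open>\<sigma> \<le> 0\<close> there is no triangle to consider, but positive constants still have to be named.\<close>

lemma basis_tensor_norm_equivalence:
  assumes i: "i \<in> dof_indices"
  shows "\<exists>c>0. \<exists>C>0. \<forall>z. pos_triangle z \<longrightarrow> shape_regularity z \<le> \<sigma> \<longrightarrow>
    c * diam z \<le> L2_norm z (basis_tensor z i) \<and> L2_norm z (basis_tensor z i) \<le> C * diam z"
proof (cases "\<sigma> > 0")
  case False
  then have "\<not> (pos_triangle z \<and> shape_regularity z \<le> \<sigma>)" for z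
    using shape_regular(1)[of z \<sigma>] by blast
  then show ?thesis by (intro exI[of _ 1] conjI) auto
next
  case True
  obtain C where tame: "tame_with \<sigma> C (\<lambda>z. basis_tensor z i)"
    using tame_basis_tensor[OF i, of \<sigma>] unfolding tame_def by (elim exE)
  note C = tame_withD[OF this]
  define c where "c = min (1/2) (1 / (24 * \<sigma>))"
  have c: "c > 0" using True by (simp add: c_def)
  define c' where "c' = c / 2 * sqrt pi * (min 1 (c / (2 * (C + 1))) / (4 * \<sigma>))"
  have c': "c' > 0"
    using c C(1) True by (simp add: c'_def)
  have C': "(C + 1) * sqrt pi > 0" using C(1) by simp
  have bounds: "c' * diam z \<le> L2_norm z (basis_tensor z i) \<and> L2_norm z (basis_tensor z i) \<le> (C + 1) * sqrt pi * diam z"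
    if z: "pos_triangle z" "shape_regularity z \<le> \<sigma>" for z
  proof
    have cont: "continuous_on UNIV (basis_tensor z i)"
      by (rule smooth_tensors_continuous[OF smooth_basis_tensor[OF z(1) i]])
    obtain x where x: "x \<in> Tri z" "c \<le> norm (basis_tensor z i x)"
      using basis_tensor_large_somewhere[OF z i] unfolding c_def by (elim bexE)
    show "c' * diam z \<le> L2_norm z (basis_tensor z i)"
      unfolding c'_def by (rule L2_norm_lower_bound[OF z tame cont x c])
    have "L2_norm z (basis_tensor z i) \<le> C * sqrt pi * diam z"
      using diam_pos[OF z(1)] by (intro L2_norm_le[OF cont C(2)[OF z] C(1)]) auto
    also have "\<dots> \<le> (C + 1) * sqrt pi * diam z"
      using diam_pos[OF z(1)] by (intro mult_right_mono) auto
    finally show "L2_norm z (basis_tensor z i) \<le> (C + 1) * sqrt pi * diam z" .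
  qed
  show ?thesis
    by (rule exI[of _ c'], rule conjI[OF c'], rule exI[of _ "(C + 1) * sqrt pi"], rule conjI[OF C']) (intro allI impI bounds)
qed

lemma BB_norm_equivalence:
  "\<exists>c>0. \<exists>C>0. \<forall>z. pos_triangle z \<longrightarrow> shape_regularity z \<le> \<sigma> \<longrightarrow>
     (\<forall>B\<in>BB z. c * diameter (Tri z) \<le> L2_norm z B \<and> L2_norm z B \<le> C * diameter (Tri z))"
proof -
  have "\<forall>i\<in>dof_indices. \<exists>p. 0 < fst p \<and> 0 < snd p \<and> (\<forall>z. pos_triangle z \<longrightarrow> shape_regularity z \<le> \<sigma> \<longrightarrow>
    fst p * diam z \<le> L2_norm z (basis_tensor z i) \<and> L2_norm z (basis_tensor z i) \<le> snd p * diam z)"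
  proof
    fix i assume "i \<in> dof_indices"
    from basis_tensor_norm_equivalence[OF this, of \<sigma>] obtain c where c: "0 < c \<and> (\<exists>C>0. \<forall>z. pos_triangle z \<longrightarrow>
      shape_regularity z \<le> \<sigma> \<longrightarrow>
      c * diam z \<le> L2_norm z (basis_tensor z i) \<and> L2_norm z (basis_tensor z i) \<le> C * diam z)"
      by (elim exE)
    from conjunct2[OF c] obtain C where "0 < C \<and> (\<forall>z. pos_triangle z \<longrightarrow> shape_regularity z \<le> \<sigma> \<longrightarrow>
      c * diam z \<le> L2_norm z (basis_tensor z i) \<and> L2_norm z (basis_tensor z i) \<le> C * diam z)"
      by (elim exE)
    with c show "\<exists>p. 0 < fst p \<and> 0 < snd p \<and> (\<forall>z. pos_triangle z \<longrightarrow> shape_regularity z \<le> \<sigma> \<longrightarrow>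
      fst p * diam z \<le> L2_norm z (basis_tensor z i) \<and> L2_norm z (basis_tensor z i) \<le> snd p * diam z)"
      by (intro exI[of _ "(c, C)"]) simp
  qed
  from bchoice[OF this] obtain p where p: "\<forall>i\<in>dof_indices. 0 < fst (p i) \<and> 0 < snd (p i) \<and>
    (\<forall>z. pos_triangle z \<longrightarrow> shape_regularity z \<le> \<sigma> \<longrightarrow>
    fst (p i) * diam z \<le> L2_norm z (basis_tensor z i) \<and> L2_norm z (basis_tensor z i) \<le> snd (p i) * diam z)"
    by (elim exE)
  define c where "c = Min ((\<lambda>i. fst (p i)) ` dof_indices)"
  define C where "C = Max ((\<lambda>i. snd (p i)) ` dof_indices)"
  have ne: "dof_indices \<noteq> {}" using card_dof_indices by force
  have c_pos: "c > 0"
    using p ne by (simp add: c_def finite_dof_indices)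
  have cC: "c \<le> fst (p i)" "snd (p i) \<le> C" if "i \<in> dof_indices" for i
    using that by (simp_all add: c_def C_def finite_dof_indices)
  have C_pos: "C > 0"
  proof -
    obtain i where i: "i \<in> dof_indices" using ne by blast
    show ?thesis using cC(2)[OF i] p i by (meson less_le_trans)
  qed
  have bounds: "c * diameter (Tri z) \<le> L2_norm z B \<and> L2_norm z B \<le> C * diameter (Tri z)"
    if z: "pos_triangle z" "shape_regularity z \<le> \<sigma>" and B: "B \<in> BB z" for z B
  proof -
    obtain i where i: "i \<in> dof_indices" and B': "B = basis_tensor z i"
      using B unfolding BB_def by (elim imageE)
    have "fst (p i) * diam z \<le> L2_norm z B" "L2_norm z B \<le> snd (p i) * diam z"
      unfolding B' using bspec[OF p i] z by simp_all
    moreover have "c * diam z \<le> fst (p i) * diam z" "snd (p i) * diam z \<le> C * diam z"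
      using cC[OF i] diam_pos[OF z(1)] by simp_all
    ultimately show ?thesis
      unfolding diam_def by linarith
  qed
  show ?thesis
    by (rule exI[of _ c], rule conjI[OF c_pos], rule exI[of _ C], rule conjI[OF C_pos])
      (intro allI impI ballI bounds)
qed

section \<open>The dual basis\<close>

theorem theorem24:
  shows "(\<forall>z. pos_triangle z \<longrightarrow>
            inj_on (basis_tensor z) dof_indices \<and> independent (BB z) \<and> span (BB z) = XX \<and>
            (\<forall>i\<in>dof_indices. \<forall>i'\<in>dof_indices.
               dof z i (basis_tensor z i') = (if i = i' then 1 else 0))) \<and>
         (\<forall>\<sigma>::real. \<exists>c>0. \<exists>C>0. \<forall>z. pos_triangle z \<longrightarrow> shape_regularity z \<le> \<sigma> \<longrightarrow>
            (\<forall>B\<in>BB z. c * diameter (Tri z) \<le> L2_norm z B \<and>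
                      L2_norm z B \<le> C * diameter (Tri z)))"
proof (intro conjI allI impI)
  fix z assume z: "pos_triangle z"
  show "inj_on (basis_tensor z) dof_indices" by (rule inj_on_basis_tensor[OF z])
  show "independent (BB z)" by (rule independent_BB[OF z])
  show "span (BB z) = XX" by (rule span_BB[OF z])
  show "\<forall>i\<in>dof_indices. \<forall>i'\<in>dof_indices. dof z i (basis_tensor z i') = (if i = i' then 1 else 0)"
    by (intro ballI dof_basis_tensor[OF z])
next
  fix \<sigma> :: real
  show "\<exists>c>0. \<exists>C>0. \<forall>z. pos_triangle z \<longrightarrow> shape_regularity z \<le> \<sigma> \<longrightarrow>
    (\<forall>B\<in>BB z. c * diameter (Tri z) \<le> L2_norm z B \<and> L2_norm z B \<le> C * diameter (Tri z))"
    by (rule BB_norm_equivalence)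
qed

end
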